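(* Let $K$ be a convex body in $\mathbb{R}^n$ whose Santaló point is the origin. For all $t\in\mathbb{R}$ with $S(K,t)\neq\emptyset$ (equivalently $t\ge\frac{|K||K^0|}{v_n^2}$), $$d_n'(t)\,E(K^0)\subseteq S(K,t)\subseteq c_n'(t)\,E(K^0),$$ where $$c_n'(t)=\frac{2\sqrt2}{\bigl((e-2)(n+1)(n+2)\bigr)^{\frac12}}\left(\frac{t v_n^2}{|K||K^0|}\right)^{\frac12}\left(1-\frac{|K||K^0|}{t v_n^2}\right)^{\frac12}$$ and $$d_n'(t)=\frac{1}{\sqrt3\,n}\left(1-\frac{|K||K^0|}{t v_n^2}\right)^{\frac12}.$$
   Context: A convex body is a compact convex set with non-empty interior. $|\cdot|$ denotes $n$-dimensional volume and $v_n$ the volume of the Euclidean unit ball of $\mathbb{R}^n$. For $x\in K$, $K^x=\{y\in\mathbb{R}^n:\langle y,z-x\rangle\le 1\text{ for all }z\in K\}$ is the polar body of $K$ with respect to $x$ (of infinite volume if $x\in\partial K$); $K^0$ is the polar with respect to the origin. The Santaló point of $K$ is the unique $x_0\in\mathrm{int}(K)$ at which $x\mapsto|K||K^{x}|$ is minimal. For $t\in\mathbb{R}$ the Santaló-region is $$S(K,t)=\Bigl\{x\in K:\ \frac{|K|\,|K^x|}{v_n^2}\le t\Bigr\}.$$ For a convex body $L$ in $\mathbb{R}^n$, the Binet ellipsoid $E(L)$ is the ellipsoid centered at the origin whose norm (i.e. the norm having $E(L)$ as unit ball) is given by $\|u\|_{E(L)}^2=\frac1{|L|}\int_L\langle x,u\rangle^2dx$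 for $u\in\mathbb{R}^n$. *)

theory Defs
  imports "HOL-Analysis.Analysis"
begin

definition convex_body :: "'a::euclidean_space set \<Rightarrow> bool" where
  "convex_body K \<longleftrightarrow> compact K \<and> convex K \<and> interior K \<noteq> {}"

definition polar_at :: "'a::euclidean_space set \<Rightarrow> 'a \<Rightarrow> 'a set" where
  "polar_at K x = {y. \<forall>z\<in>K. y \<bullet> (z - x) \<le> 1}"

text \<open>
  \<open>emeasure\<close> rather than \<open>measure\<close>: the polar at a boundary point has infinite volume,
  which \<open>measure\<close> would send to 0.
\<close>
definition volume_product :: "'a::euclidean_space set \<Rightarrow> 'a \<Rightarrow> ennreal" where
  "volume_product K x = emeasure lebesgue K * emeasure lebesgue (polar_at K x)"

text \<open>
  The minimiser of the volume product over \<open>interior K\<close> is unique for a convex body \<open>K\<close>;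
  uniqueness is a theorem and is not part of the definition.
\<close>
definition is_santalo_point :: "'a::euclidean_space set \<Rightarrow> 'a \<Rightarrow> bool" where
  "is_santalo_point K p \<longleftrightarrow>
     p \<in> interior K \<and> (\<forall>x\<in>interior K. volume_product K p \<le> volume_product K x)"

text \<open>The comparison takes place in \<open>ereal\<close>, since \<open>t\<close> may be negative and
  \<open>ennreal\<close> truncates negative reals to 0.\<close>
definition santalo_region :: "'a::euclidean_space set \<Rightarrow> real \<Rightarrow> 'a set" where
  "santalo_region K t =
     {x \<in> K. enn2ereal (volume_product K x / (emeasure lebesgue (cball (0::'a) 1))\<^sup>2) \<le> ereal t}"

definition binet_norm :: "'a::euclidean_space set \<Rightarrow> 'a \<Rightarrow> real" where
  "binet_norm L u = sqrt (1 / measure lebesgue L * (LINT x:L|lebesgue. (x \<bullet> u)\<^sup>2))"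

definition binet_ellipsoid :: "'a::euclidean_space set \<Rightarrow> 'a set" where
  "binet_ellipsoid L = {u. binet_norm L u \<le> 1}"

text \<open>
  The real number $|K|\,|K^0| / v_n^2$; the volumes are finite when \<open>K\<close> is compact and
  \<open>0 \<in> interior K\<close>.
\<close>
definition normalized_product0 :: "'a::euclidean_space set \<Rightarrow> real" where
  "normalized_product0 K =
     measure lebesgue K * measure lebesgue (polar_at K 0) / (measure lebesgue (cball (0::'a) 1))\<^sup>2"

definition outer_factor :: "(real ^ 'n) set \<Rightarrow> real \<Rightarrow> real" where
  "outer_factor K t =
     2 * sqrt 2 / sqrt ((exp 1 - 2) * (real CARD('n) + 1) * (real CARD('n) + 2))
     * sqrt (t / normalized_product0 K) * sqrt (1 - normalized_product0 K / t)"

definition inner_factor :: "(real ^ 'n) set \<Rightarrow> real \<Rightarrow> real" where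
  "inner_factor K t = 1 / (sqrt 3 * real CARD('n)) * sqrt (1 - normalized_product0 K / t)"

end

theory Submission imports Defs "HOL-Probability.Distributions" begin

text \<open>
  Write \<open>n\<close> for the dimension and \<open>L\<close> for the polar of \<open>K\<close> with respect to the origin, and fix a point
  \<open>x\<close>.  Integrating \<open>exp (- \<tau>)\<close> over the cone spanned by a polar body, and shifting \<open>\<tau>\<close> by
  \<open>x \<bullet> y\<close>, gives for every \<open>x \<in> K\<close>

    (1)  the volume of the polar at \<open>x\<close> equals the integral over \<open>y \<in> L\<close> of
         \<open>1 / (1 - x \<bullet> y) ^ (n + 1)\<close>   (\<open>emeasure_polar_at\<close>).

  The derivative of the right-hand side at \<open>x = 0\<close> is \<open>n + 1\<close> times the integral of \<open>x \<bullet> y\<close>, so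
  the minimality of the origin says that \<open>L\<close> has its barycentre there
  (\<open>santalo_point_imp_polar_centered\<close>).  Both inclusions are therefore estimates for (1) in terms
  of the second moment of the functional \<open>y \<mapsto> x \<bullet> y\<close> on a centred convex body, and both follow from a
  single extremal principle.

  The principle (\<open>cone_comparison\<close>): among centred bodies with a given second moment of
  \<open>x \<bullet> y\<close>, the integral of \<open>h (x \<bullet> y)\<close> is largest for the cone whose apex is its highest point, for
  every \<open>h\<close> with a nonnegative convex derivative.  By the Brunn-Minkowski inequality the
  \<open>n\<close>-th root of the volume of the cap \<open>{y \<in> L. a \<le> x \<bullet> y}\<close> is concave in \<open>a\<close> where that volume is
  positive (\<open>root_tail_concave\<close>); for the cone it is affine between base and apex.  So, as
  fractions of the whole, the cap volumes of the body exceed those of the cone on an interval only.  Their difference is orthogonal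
  to \<open>1\<close> and to \<open>a\<close>, because volume, barycentre and second moment agree, and a
  function with these properties has a nonpositive integral against every nonnegative convex
  function: subtract the secant through the end points of the interval
  (\<open>integral_mult_convex_nonpos\<close>).  Brunn-Minkowski itself comes from the Prekopa-Leindler
  inequality for midpoints, proved by induction on the number of coordinates
  (\<open>prekopa_leindler_midpoint\<close>).

  The principle is used three times, with \<open>r\<close> the height of the apex of the cone, so that \<open>r^2\<close> is
  \<open>n (n + 2)\<close> times the mean of \<open>(x \<bullet> y)^2\<close>.
  First, \<open>x \<bullet> y \<le> r\<close> on \<open>L\<close>, since the cone does not reach higher (\<open>functional_le\<close>).
  Secondly, if \<open>r < 1\<close>, the mean of \<open>1 / (1 - x \<bullet> y) ^ (n + 1)\<close> is at most
  \<open>1 / ((1 - r) (1 + r / n) ^ n) \<le> 1 / (1 - r^2)\<close> (\<open>integral_inverse_power_le\<close>).  On the inner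
  ellipsoid \<open>r^2 \<le> 3 n^2 \<cdot> inner_factor^2 < 1\<close>, which gives the first inclusion.
  Thirdly, the part of the body where \<open>x \<bullet> y\<close> is positive carries at least the fraction
  \<open>1 - 2 / e\<close> of the second moment (\<open>second_moment_le_upper\<close>); together with
  \<open>(1 - s) ^ - (n + 1) \<ge> 1 + (n + 1) s + (n + 1) (n + 2) / 2 \<cdot> max 0 s ^ 2\<close> this bounds the second moment
  in terms of (1) and gives the second inclusion.
\<close>

section \<open>The Prekopa-Leindler inequality at midpoints\<close>

text \<open>
  The set of midpoints contains a half-size copy of \<open>T\<close>, taken with the least point of
  \<open>U\<close>, to the left of a half-size copy of \<open>U\<close>, taken with the greatest
  point of \<open>T\<close>; the copies have at most one common point.
\<close>
lemma midpoint_set_compact_real: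
  fixes T U C :: "real set"
  assumes T: "compact T" "T \<noteq> {}" and U: "compact U" "U \<noteq> {}" and C: "C \<in> sets borel"
    and mid: "\<And>x y. x \<in> T \<Longrightarrow> y \<in> U \<Longrightarrow> (x + y) / 2 \<in> C"
  shows "emeasure lborel T + emeasure lborel U \<le> 2 * emeasure lborel C"
proof -
  obtain q where q: "q \<in> T" "\<And>x. x \<in> T \<Longrightarrow> x \<le> q"
    using compact_attains_sup[OF T] by blast
  obtain p where p: "p \<in> U" "\<And>y. y \<in> U \<Longrightarrow> p \<le> y"
    using compact_attains_inf[OF U] by blast
  define T' where "T' = (\<lambda>x. p / 2 + (1/2) *\<^sub>R x) ` T"
  define U' where "U' = (\<lambda>x. q / 2 + (1/2) *\<^sub>R x) ` U"
  have cT: "compact T'" and cU: "compact U'"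
    unfolding T'_def U'_def by (intro compact_continuous_image T U continuous_intros)+
  have bT: "T' \<in> sets borel" "U' \<in> sets borel" "T \<in> sets borel" "U \<in> sets borel"
    using cT cU T U by (auto intro: borel_compact)
  have scale: "emeasure lborel ((\<lambda>x. d + (1/2) *\<^sub>R x) ` S) = ennreal (1/2) * emeasure lborel S"
    if "compact S" for S and d :: real
  proof -
    have "compact ((\<lambda>x. d + (1/2) *\<^sub>R x) ` S)"
      by (intro compact_continuous_image that continuous_intros)
    then show ?thesis
      using emeasure_lebesgue_affine[of "1/2" d S] that by (simp add: borel_compact add.commute)
  qed
  have two: "2 * (ennreal (1/2) * z) = z" for z
  proof -
    have "(2::ennreal) * ennreal (1/2) = ennreal (2 * (1/2))"
      by (subst ennreal_mult) auto
    then show ?thesis by (simp add: mult.assoc[symmetric])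
  qed
  have sub: "T' \<union> U' \<subseteq> C"
    using mid[OF _ p(1)] mid[OF q(1)] by (auto simp: T'_def U'_def add_divide_distrib add.commute)
  have "T' \<inter> U' \<subseteq> {(p + q) / 2}"
    using p(2) q(2) by (fastforce simp: T'_def U'_def)
  then have "emeasure lborel (T' \<inter> U') \<le> emeasure lborel {(p + q) / 2}"
    by (intro emeasure_mono) auto
  then have null: "emeasure lborel (T' \<inter> U') = 0" by simp
  have "emeasure lborel T' + emeasure lborel U' = emeasure lborel (T' \<union> U') + emeasure lborel (T' \<inter> U')"
    using bT by (intro emeasure_Un_Int) auto
  also have "\<dots> \<le> emeasure lborel C"
    using null sub C by (simp add: emeasure_mono)
  finally have "2 * (emeasure lborel T' + emeasure lborel U') \<le> 2 * emeasure lborel C"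
    by (intro mult_left_mono) auto
  then show ?thesis
    unfolding T'_def U'_def scale[OF T(1)] scale[OF U(1)] distrib_left two .
qed

text \<open>
  The empty set is excluded so that the midpoint inequality, which fails when one of the two sets is
  empty, applies to every member of the family.
\<close>
lemma emeasure_lborel_inner_compact:
  fixes S :: "'a::euclidean_space set"
  assumes S: "S \<in> sets borel" "S \<noteq> {}"
  shows "emeasure lborel S = (SUP T \<in> {T. compact T \<and> T \<subseteq> S \<and> T \<noteq> {}}. emeasure lborel T)"
proof (rule antisym)
  obtain s where s: "s \<in> S" using S by auto
  show "emeasure lborel S \<le> (SUP T \<in> {T. compact T \<and> T \<subseteq> S \<and> T \<noteq> {}}. emeasure lborel T)"
    (is "_ \<le> ?sup")
  proof (rule ennreal_le_epsilon)
    fix e :: real assume e: "0 < e"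
    obtain T where T: "closed T" "T \<subseteq> S" "emeasure lebesgue (S - T) < ennreal e"
      by (rule sets_lebesgue_inner_closed[of S e]) (use S e in auto)
    (* The closed set T is exhausted by balls; inserting s keeps the compact subsets nonempty. *)
    have bT: "T \<in> sets borel" using T by auto
    have le: "emeasure lborel T \<le> ?sup"
    proof -
      have "(SUP k. emeasure lborel (T \<inter> cball 0 (real k))) = emeasure lborel (\<Union>k. T \<inter> cball 0 (real k))"
        using bT by (intro SUP_emeasure_incseq) (auto simp: incseq_def)
      also have "(\<Union>k. T \<inter> cball 0 (real k)) = T"
        using real_arch_simple by auto
      finally have eq: "emeasure lborel T = (SUP k. emeasure lborel (T \<inter> cball 0 (real k)))" ..
      have "emeasure lborel (T \<inter> cball 0 (real k)) \<le> ?sup" for k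
      proof -
        have "emeasure lborel (T \<inter> cball 0 (real k)) \<le> emeasure lborel (insert s (T \<inter> cball 0 (real k)))"
          using bT by (intro emeasure_mono) auto
        also have "\<dots> \<le> ?sup"
          using T s by (intro SUP_upper) (auto intro!: compact_insert closed_Int_compact)
        finally show ?thesis .
      qed
      then show ?thesis unfolding eq by (rule SUP_least)
    qed
    have "emeasure lborel S = emeasure lborel T + emeasure lborel (S - T)"
      using bT S T by (subst plus_emeasure) (auto simp: Un_absorb1)
    also have "emeasure lborel (S - T) \<le> ennreal e"
      using T(3) bT S by simp
    finally show "emeasure lborel S \<le> ?sup + ennreal e"
      using le by (meson add_mono order_trans order_refl)
  qed
qed (use S in \<open>auto intro!: SUP_least emeasure_mono\<close>)

lemma midpoint_set_real:
  fixes A B C :: "real set"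
  assumes A: "A \<in> sets borel" "A \<noteq> {}" and B: "B \<in> sets borel" "B \<noteq> {}" and C: "C \<in> sets borel"
    and mid: "\<And>x y. x \<in> A \<Longrightarrow> y \<in> B \<Longrightarrow> (x + y) / 2 \<in> C"
  shows "emeasure lborel A + emeasure lborel B \<le> 2 * emeasure lborel C"
proof -
  let ?I = "\<lambda>S::real set. {T. compact T \<and> T \<subseteq> S \<and> T \<noteq> {}}"
  have ne: "?I S \<noteq> {}" if "S \<noteq> {}" for S
    using that compact_sing by blast
  have "emeasure lborel A + emeasure lborel U \<le> 2 * emeasure lborel C" if "U \<in> ?I B" for U
    unfolding emeasure_lborel_inner_compact[OF A] ennreal_SUP_add_left[OF ne[OF A(2)], symmetric]
    using that by (intro SUP_least midpoint_set_compact_real C) (auto intro: mid)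
  then show ?thesis
    unfolding emeasure_lborel_inner_compact[OF B] ennreal_SUP_add_right[OF ne[OF B(2)]]
    by (rule SUP_least)
qed

lemma nn_integral_layer_real:
  fixes f :: "'a \<Rightarrow> real"
  assumes [measurable]: "f \<in> borel_measurable M" and "sigma_finite_measure M"
    and f: "\<And>x. 0 \<le> f x"
  shows "(\<integral>\<^sup>+x. ennreal (f x) \<partial>M) = (\<integral>\<^sup>+t. emeasure M {x\<in>space M. t < f x} * indicator {0..} t \<partial>lborel)"
proof -
  interpret sigma_finite_measure M by fact
  interpret pair_sigma_finite lborel M by standard
  have "(\<integral>\<^sup>+x. ennreal (f x) \<partial>M) = (\<integral>\<^sup>+x. \<integral>\<^sup>+t. indicator {0..<f x} t \<partial>lborel \<partial>M)"
    using f by (intro nn_integral_cong) simp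
  also have "\<dots> = (\<integral>\<^sup>+t. \<integral>\<^sup>+x. indicator {0..<f x} t \<partial>M \<partial>lborel)"
    by (subst Fubini') (auto simp: indicator_def)
  also have "\<dots> = (\<integral>\<^sup>+t. emeasure M {x\<in>space M. t < f x} * indicator {0..} t \<partial>lborel)"
  proof (intro nn_integral_cong)
    fix t :: real
    have "(\<integral>\<^sup>+x. indicator {0..<f x} t \<partial>M)
        = (\<integral>\<^sup>+x. indicator {x\<in>space M. t < f x} x * indicator {0..} t \<partial>M)"
      by (intro nn_integral_cong) (auto simp: indicator_def)
    then show "(\<integral>\<^sup>+x. indicator {0..<f x} t \<partial>M) = emeasure M {x\<in>space M. t < f x} * indicator {0..} t"
      by (simp add: nn_integral_multc)
  qed
  finally show ?thesis .
qed

text \<open>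
  Since both functions have supremum 1, the sets \<open>{f > t}\<close> and \<open>{g > t}\<close>
  are nonempty for the same levels \<open>t\<close>. Their midpoints lie in \<open>{h > t}\<close>,
  and integrating the one-dimensional Brunn-Minkowski inequality over \<open>t\<close> gives an
  additive bound, which is stronger than the multiplicative one.
\<close>
lemma prekopa_leindler_real_normalized:
  fixes f g h :: "real \<Rightarrow> real"
  assumes [measurable]: "f \<in> borel_measurable borel" "g \<in> borel_measurable borel" "h \<in> borel_measurable borel"
    and f: "\<And>x. 0 \<le> f x" "\<And>x. f x \<le> 1" "\<And>t. t < 1 \<Longrightarrow> \<exists>x. t < f x"
    and g: "\<And>x. 0 \<le> g x" "\<And>x. g x \<le> 1" "\<And>t. t < 1 \<Longrightarrow> \<exists>x. t < g x"
    and h: "\<And>x. 0 \<le> h x" "\<And>x y. f x * g y \<le> (h ((x + y) / 2))\<^sup>2"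
  shows "(\<integral>\<^sup>+x. f x \<partial>lborel) + (\<integral>\<^sup>+x. g x \<partial>lborel) \<le> 2 * (\<integral>\<^sup>+x. h x \<partial>lborel)"
proof -
  have lev: "emeasure lborel {x. t < f x} + emeasure lborel {x. t < g x} \<le> 2 * emeasure lborel {x. t < h x}"
    if t: "0 \<le> t" for t
  proof (cases "t < 1")
    case True
    show ?thesis
    proof (rule midpoint_set_real)
      fix x y assume "x \<in> {x. t < f x}" "y \<in> {x. t < g x}"
      then have "t * t < f x * g y" using t by (auto intro: mult_strict_mono')
      also have "\<dots> \<le> (h ((x + y) / 2))\<^sup>2" by (rule h)
      finally show "(x + y) / 2 \<in> {x. t < h x}"
        using h(1) by (auto simp: power2_eq_square[symmetric] intro: power2_less_imp_less)
    qed (use f(3) g(3) True in auto)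
  next
    case False
    then have "{x. t < f x} = {}" "{x. t < g x} = {}" 
      using f(2) g(2) by (auto simp: not_less intro: order_trans)
    then show ?thesis by simp
  qed
  have L: "sigma_finite_measure (lborel :: real measure)" by standard
  have "(\<integral>\<^sup>+x. f x \<partial>lborel) + (\<integral>\<^sup>+x. g x \<partial>lborel)
    = (\<integral>\<^sup>+t. emeasure lborel {x. t < f x} * indicator {0..} t + emeasure lborel {x. t < g x} * indicator {0..} t \<partial>lborel)"
    by (subst (1 2) nn_integral_layer_real) (auto simp: L f g nn_integral_add)
  also have "\<dots> \<le> (\<integral>\<^sup>+t. 2 * (emeasure lborel {x. t < h x} * indicator {0..} t) \<partial>lborel)"
    using lev by (intro nn_integral_mono) (auto simp: indicator_def)
  also have "\<dots> = 2 * (\<integral>\<^sup>+x. h x \<partial>lborel)"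
    by (subst nn_integral_cmult) (auto simp: L h nn_integral_layer_real)
  finally show ?thesis .
qed

lemma ennreal_mult_le_square_of_mean:
  fixes a b c :: ennreal
  assumes "a + b \<le> 2 * c"
  shows "a * b \<le> c\<^sup>2"
proof (cases c)
  case (real r)
  have "2 * ennreal r = ennreal (2 * r)" using real by (simp add: ennreal_mult)
  then have ab: "a + b \<le> ennreal (2 * r)" using assms real by simp
  have "a + b < top" using ab by (rule le_less_trans) simp
  then have "a < top" "b < top" by auto
  then obtain x y where xy: "a = ennreal x" "b = ennreal y" "0 \<le> x" "0 \<le> y"
    by (cases a; cases b; simp)
  have "x + y \<le> 2 * r" using ab xy real by (simp add: ennreal_plus[symmetric] del: ennreal_plus)
  then have "(x + y)\<^sup>2 \<le> (2 * r)\<^sup>2" using xy by (intro power_mono) auto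
  moreover have "4 * (x * y) \<le> (x + y)\<^sup>2"
    using zero_le_power2[of "x - y"] by (simp add: power2_eq_square algebra_simps)
  ultimately have "x * y \<le> r\<^sup>2" by (simp add: power2_eq_square)
  then show ?thesis using xy real by (simp add: ennreal_mult[symmetric] ennreal_power)
qed (simp add: power2_eq_square ennreal_top_mult)

text \<open>
  Dividing \<open>f\<close> and \<open>g\<close> by their suprema \<open>F\<close> and
  \<open>G\<close>, and \<open>h\<close> by \<open>sqrt (F * G)\<close>, reduces to the normalised
  case; the arithmetic-geometric mean inequality turns its additive conclusion into a product.
\<close>
lemma prekopa_leindler_real_bounded:
  fixes f g h :: "real \<Rightarrow> ennreal"
  assumes [measurable]: "f \<in> borel_measurable borel" "g \<in> borel_measurable borel" "h \<in> borel_measurable borel"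
    and fb: "\<And>x. f x \<le> ennreal b" and gb: "\<And>x. g x \<le> ennreal b"
    and h: "\<And>x y. f x * g y \<le> (h ((x + y) / 2))\<^sup>2"
  shows "(\<integral>\<^sup>+x. f x \<partial>lborel) * (\<integral>\<^sup>+x. g x \<partial>lborel) \<le> (\<integral>\<^sup>+x. h x \<partial>lborel)\<^sup>2"
proof (cases "(SUP x. f x) = 0 \<or> (SUP x. g x) = 0")
  case True
  then have "(\<forall>x. f x = 0) \<or> (\<forall>x. g x = 0)"
    by (metis SUP_upper UNIV_I le_zero_eq)
  then show ?thesis by auto
next
  case False
  have "(SUP x. f x) \<le> ennreal b" "(SUP x. g x) \<le> ennreal b"
    using fb gb by (auto intro!: SUP_least)
  then have "(SUP x. f x) < top" "(SUP x. g x) < top"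
    by (auto elim!: le_less_trans)
  then obtain F G where FG: "(SUP x. f x) = ennreal F" "(SUP x. g x) = ennreal G" "0 \<le> F" "0 \<le> G"
    by (cases "SUP x. f x"; cases "SUP x. g x"; simp)
  then have pos: "0 < F" "0 < G" using False by (auto simp: less_le)
  have fF: "f x \<le> ennreal F" and gG: "g x \<le> ennreal G" for x
    using FG by (metis SUP_upper UNIV_I)+
  define c where "c = sqrt (F * G)"
  have c: "0 < c" "c\<^sup>2 = F * G" using pos by (auto simp: c_def)
  define f' where "f' x = enn2real (f x) / F" for x
  define g' where "g' x = enn2real (g x) / G" for x
  define h' where "h' x = enn2real (min (h x) (ennreal c)) / c" for x
  have [measurable]: "f' \<in> borel_measurable borel" "g' \<in> borel_measurable borel" "h' \<in> borel_measurable borel"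
    unfolding f'_def g'_def h'_def by measurable
  have f'eq: "ennreal (f' x) * ennreal F = f x" and g'eq: "ennreal (g' x) * ennreal G = g x" for x
    unfolding f'_def g'_def using pos fF[of x] gG[of x]
    by (auto simp: ennreal_mult[symmetric] intro!: ennreal_enn2real elim: le_less_trans)
  have h'le: "ennreal (h' x) * ennreal c \<le> h x" for x
  proof -
    have "min (h x) (ennreal c) < top" by (simp add: min_less_iff_disj)
    then have "ennreal (h' x) * ennreal c = min (h x) (ennreal c)"
      unfolding h'_def using c by (simp add: ennreal_mult[symmetric])
    then show ?thesis by simp
  qed
  have f'0: "0 \<le> f' x" "0 \<le> g' x" "0 \<le> h' x" for x
    unfolding f'_def g'_def h'_def using pos c by auto
  have f'1: "f' x \<le> 1" for x
    using fF[of x] pos unfolding f'_def by (simp add: enn2real_leI)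
  have g'1: "g' x \<le> 1" for x
    using gG[of x] pos unfolding g'_def by (simp add: enn2real_leI)
  have f's: "\<exists>x. t < f' x" if "t < 1" for t
  proof (cases "0 \<le> t")
    case True
    have "ennreal (t * F) < (SUP x. f x)" unfolding FG using that pos True by (intro ennreal_lessI) auto
    then obtain x where "ennreal (t * F) < f x" by (auto simp: less_SUP_iff)
    also have "f x = ennreal (f' x * F)" using f'eq[of x] f'0 pos by (simp add: ennreal_mult)
    finally have "t * F < f' x * F" using True pos f'0 by (simp add: ennreal_less_iff)
    then show ?thesis using pos by auto
  next
    case False
    then have "t < f' 0" "t < g' 0" using f'0[of 0] by auto
    then show ?thesis by blast
  qed
  have g's: "\<exists>x. t < g' x" if "t < 1" for t
  proof (cases "0 \<le> t")
    case True
    have "ennreal (t * G) < (SUP x. g x)" unfolding FG using that pos True by (intro ennreal_lessI) auto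
    then obtain x where "ennreal (t * G) < g x" by (auto simp: less_SUP_iff)
    also have "g x = ennreal (g' x * G)" using g'eq[of x] f'0 pos by (simp add: ennreal_mult)
    finally have "t * G < g' x * G" using True pos f'0 by (simp add: ennreal_less_iff)
    then show ?thesis using pos by auto
  next
    case False
    then have "t < f' 0" "t < g' 0" using f'0[of 0] by auto
    then show ?thesis by blast
  qed
  have h'h: "f' x * g' y \<le> (h' ((x + y) / 2))\<^sup>2" for x y
  proof (cases "h ((x + y) / 2) \<le> ennreal c")
    case True
    then obtain r where r: "h ((x + y) / 2) = ennreal r" "0 \<le> r"
      by (cases "h ((x + y) / 2)") (auto simp: top_unique)
    have "ennreal ((f' x * F) * (g' y * G)) \<le> ennreal (r\<^sup>2)"
      using h[of x y] f'eq[of x] g'eq[of y] f'0 pos r by (simp add: ennreal_mult ennreal_power)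
    then have "(f' x * F) * (g' y * G) \<le> r\<^sup>2" by simp
    then have "f' x * g' y * c\<^sup>2 \<le> r\<^sup>2" by (simp add: c mult_ac)
    moreover have "h' ((x + y) / 2) = r / c" using True r by (simp add: h'_def min_absorb1)
    ultimately show ?thesis using c(1) by (simp add: power_divide pos_le_divide_eq)
  next
    case False
    then have "h' ((x + y) / 2) = 1" using c by (simp add: h'_def min_absorb2)
    then show ?thesis using f'1[of x] g'1[of y] f'0 by (simp add: mult_le_one)
  qed
  have main: "(\<integral>\<^sup>+x. f' x \<partial>lborel) * (\<integral>\<^sup>+x. g' x \<partial>lborel) \<le> (\<integral>\<^sup>+x. h' x \<partial>lborel)\<^sup>2"
    by (intro ennreal_mult_le_square_of_mean prekopa_leindler_real_normalized)
       (use f'0 f'1 g'1 f's g's h'h in auto)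
  have "(\<integral>\<^sup>+x. f x \<partial>lborel) * (\<integral>\<^sup>+x. g x \<partial>lborel)
      = ((\<integral>\<^sup>+x. f' x \<partial>lborel) * ennreal F) * ((\<integral>\<^sup>+x. g' x \<partial>lborel) * ennreal G)"
    unfolding f'eq[symmetric] g'eq[symmetric] by (simp add: nn_integral_multc)
  also have "\<dots> = ((\<integral>\<^sup>+x. f' x \<partial>lborel) * (\<integral>\<^sup>+x. g' x \<partial>lborel)) * ennreal (c\<^sup>2)"
    using pos by (simp add: c ennreal_mult mult_ac)
  also have "\<dots> \<le> (\<integral>\<^sup>+x. h' x \<partial>lborel)\<^sup>2 * ennreal (c\<^sup>2)"
    by (intro mult_right_mono main) auto
  also have "\<dots> = (\<integral>\<^sup>+x. ennreal (h' x) * ennreal c \<partial>lborel)\<^sup>2"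
    using c(1) by (simp add: nn_integral_multc power_mult_distrib ennreal_power)
  also have "\<dots> \<le> (\<integral>\<^sup>+x. h x \<partial>lborel)\<^sup>2"
    by (intro power_mono nn_integral_mono h'le) auto
  finally show ?thesis .
qed

lemma prekopa_leindler_real:
  fixes f g h :: "real \<Rightarrow> ennreal"
  assumes [measurable]: "f \<in> borel_measurable borel" "g \<in> borel_measurable borel" "h \<in> borel_measurable borel"
    and h: "\<And>x y. f x * g y \<le> (h ((x + y) / 2))\<^sup>2"
  shows "(\<integral>\<^sup>+x. f x \<partial>lborel) * (\<integral>\<^sup>+x. g x \<partial>lborel) \<le> (\<integral>\<^sup>+x. h x \<partial>lborel)\<^sup>2"
proof -
  have trunc: "(\<integral>\<^sup>+x. u x \<partial>lborel) = (SUP k. \<integral>\<^sup>+x. min (u x) (of_nat k) \<partial>lborel)"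
    if [measurable]: "u \<in> borel_measurable borel" for u :: "real \<Rightarrow> ennreal"
  proof -
    have "(SUP k. min (u x) (of_nat k)) = u x" for x
    proof -
      have "(SUP k. inf (u x) (of_nat k)) = inf (u x) (SUP k. of_nat k)"
        by (simp add: inf_SUP)
      then show ?thesis by (simp add: inf_min ennreal_SUP_of_nat_eq_top)
    qed
    then have "(\<integral>\<^sup>+x. u x \<partial>lborel) = (\<integral>\<^sup>+x. (SUP k. min (u x) (of_nat k)) \<partial>lborel)" by simp
    also have "\<dots> = (SUP k. \<integral>\<^sup>+x. min (u x) (of_nat k) \<partial>lborel)"
      by (intro nn_integral_monotone_convergence_SUP)
         (auto simp: incseq_def le_fun_def min_le_iff_disj intro: min.mono)
    finally show ?thesis .
  qed
  have "(\<integral>\<^sup>+x. min (f x) (of_nat j) \<partial>lborel) * (\<integral>\<^sup>+x. min (g x) (of_nat k) \<partial>lborel)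
     \<le> (\<integral>\<^sup>+x. h x \<partial>lborel)\<^sup>2" for j k :: nat
  proof (rule prekopa_leindler_real_bounded[where b = "real (max j k)"])
    show "min (f x) (of_nat j) \<le> ennreal (real (max j k))" for x
      by (rule min.coboundedI2) (simp add: ennreal_of_nat_eq_real_of_nat)
    show "min (g x) (of_nat k) \<le> ennreal (real (max j k))" for x
      by (rule min.coboundedI2) (simp add: ennreal_of_nat_eq_real_of_nat)
    show "min (f x) (of_nat j) * min (g y) (of_nat k) \<le> (h ((x + y) / 2))\<^sup>2" for x y
      by (rule order_trans[OF mult_mono h]) auto
  qed measurable
  then show ?thesis
    unfolding trunc[OF assms(1)] trunc[OF assms(2)]
    unfolding SUP_mult_right_ennreal SUP_mult_left_ennreal by (intro SUP_least)
qed

text \<open>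
  Integrating out one coordinate turns \<open>f\<close>, \<open>g\<close>, \<open>h\<close> into
  functions of the remaining coordinates that satisfy the same hypothesis, by the one-dimensional
  case.
\<close>
lemma prekopa_leindler_PiM:
  fixes f g h :: "('i \<Rightarrow> real) \<Rightarrow> ennreal"
  assumes "finite I"
    and "f \<in> borel_measurable (PiM I (\<lambda>_. lborel))" "g \<in> borel_measurable (PiM I (\<lambda>_. lborel))"
      "h \<in> borel_measurable (PiM I (\<lambda>_. lborel))"
    and "\<And>x y. x \<in> extensional I \<Longrightarrow> y \<in> extensional I \<Longrightarrow> f x * g y \<le> (h (\<lambda>i\<in>I. (x i + y i) / 2))\<^sup>2"
  shows "(\<integral>\<^sup>+x. f x \<partial>PiM I (\<lambda>_. lborel)) * (\<integral>\<^sup>+x. g x \<partial>PiM I (\<lambda>_. lborel))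
      \<le> (\<integral>\<^sup>+x. h x \<partial>PiM I (\<lambda>_. lborel))\<^sup>2"
  using assms
proof (induction I arbitrary: f g h rule: finite_induct)
  case empty
  interpret product_sigma_finite "\<lambda>_::'i. lborel :: real measure" by standard
  have point: "(\<integral>\<^sup>+x. u x \<partial>PiM {} (\<lambda>_. lborel :: real measure)) = u (\<lambda>_. undefined)" for u :: "('i \<Rightarrow> real) \<Rightarrow> ennreal"
  proof -
    have "(\<integral>\<^sup>+x. u x \<partial>PiM {} (\<lambda>_. lborel :: real measure)) = (\<integral>\<^sup>+(x :: 'i \<Rightarrow> real). u (\<lambda>_. undefined) \<partial>PiM {} (\<lambda>_. lborel :: real measure))"
      by (intro nn_integral_cong) (simp add: space_PiM_empty)
    then show ?thesis by (simp add: space_PiM_empty)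
  qed
  show ?case using empty(4)[of "\<lambda>_. undefined" "\<lambda>_. undefined"] 
    by (simp add: point restrict_def)
next
  case (insert i I)
  interpret product_sigma_finite "\<lambda>_::'i. lborel :: real measure" by standard
  note [measurable] = insert.prems(1-3)
  define f' where "f' x = (\<integral>\<^sup>+t. f (x(i := t)) \<partial>lborel)" for x
  define g' where "g' x = (\<integral>\<^sup>+t. g (x(i := t)) \<partial>lborel)" for x
  define h' where "h' x = (\<integral>\<^sup>+t. h (x(i := t)) \<partial>lborel)" for x
  have m[measurable]: "f' \<in> borel_measurable (PiM I (\<lambda>_. lborel))" "g' \<in> borel_measurable (PiM I (\<lambda>_. lborel))"
    "h' \<in> borel_measurable (PiM I (\<lambda>_. lborel))"
    unfolding f'_def g'_def h'_def by measurable
  have "f' x * g' y \<le> (h' (\<lambda>i\<in>I. (x i + y i) / 2))\<^sup>2"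
    if x: "x \<in> extensional I" and y: "y \<in> extensional I" for x y
    unfolding f'_def g'_def h'_def
  proof (rule prekopa_leindler_real)
    let ?m = "\<lambda>j\<in>I. (x j + y j) / 2"
    have sp: "x \<in> space (PiM I (\<lambda>_. lborel))" "y \<in> space (PiM I (\<lambda>_. lborel))" "?m \<in> space (PiM I (\<lambda>_. lborel))"
      using x y by (auto simp: space_PiM PiE_def)
    have "(\<lambda>t. z(i := t)) \<in> measurable borel (PiM (insert i I) (\<lambda>_. lborel))"
      if "z \<in> space (PiM I (\<lambda>_. lborel))" for z
      using measurable_fun_upd[of "insert i I" I i "\<lambda>_. z" borel "\<lambda>_. lborel" "\<lambda>t. t"] that insert.hyps
      by (auto simp: measurable_ident_sets)
    note mu = this
    show "(\<lambda>t. f (x(i := t))) \<in> borel_measurable borel" "(\<lambda>t. g (y(i := t))) \<in> borel_measurable borel"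
      "(\<lambda>t. h (?m(i := t))) \<in> borel_measurable borel"
      using mu sp by (auto intro: measurable_compose[OF _ insert.prems(1)] measurable_compose[OF _ insert.prems(2)]
         measurable_compose[OF _ insert.prems(3)])
    show "f (x(i := s)) * g (y(i := t)) \<le> (h (?m(i := (s + t) / 2)))\<^sup>2" for s t
    proof -
      have "(\<lambda>j\<in>insert i I. ((x(i := s)) j + (y(i := t)) j) / 2) = ?m(i := (s + t) / 2)"
        using insert.hyps by (auto simp: restrict_def fun_eq_iff)
      moreover have "x(i := s) \<in> extensional (insert i I)" "y(i := t) \<in> extensional (insert i I)"
        using x y by (auto simp: extensional_def)
      ultimately show ?thesis
        using insert.prems(4)[of "x(i := s)" "y(i := t)"] by (simp only:)
    qed
  qed
  from insert.IH[OF m this] show ?case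
    unfolding f'_def g'_def h'_def product_nn_integral_insert[OF insert.hyps insert.prems(1)]
      product_nn_integral_insert[OF insert.hyps insert.prems(2)] product_nn_integral_insert[OF insert.hyps insert.prems(3)] .
qed

text \<open>
  The inequality for the weights 1/2 and 1/2, squared so that no square roots of extended
  nonnegative reals occur. Continuity recovers the other weights where they are needed.
\<close>
theorem prekopa_leindler_midpoint:
  fixes f g h :: "'a::euclidean_space \<Rightarrow> ennreal"
  assumes m: "f \<in> borel_measurable borel" "g \<in> borel_measurable borel" "h \<in> borel_measurable borel"
    and h: "\<And>x y. f x * g y \<le> (h ((1/2) *\<^sub>R (x + y)))\<^sup>2"
  shows "(\<integral>\<^sup>+x. f x \<partial>lborel) * (\<integral>\<^sup>+x. g x \<partial>lborel) \<le> (\<integral>\<^sup>+x. h x \<partial>lborel)\<^sup>2"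
proof -
  let ?P = "PiM (Basis :: 'a set) (\<lambda>_. lborel :: real measure)"
  let ?e = "\<lambda>f. \<Sum>b\<in>(Basis :: 'a set). f b *\<^sub>R b"
  have [measurable]: "?e \<in> measurable ?P borel" by measurable
  have eq: "(\<integral>\<^sup>+x. u x \<partial>lborel) = (\<integral>\<^sup>+x. u (?e x) \<partial>?P)" if "u \<in> borel_measurable borel" for u :: "'a \<Rightarrow> ennreal"
    using that by (subst lborel_eq) (simp add: nn_integral_distr)
  have "(\<integral>\<^sup>+x. f (?e x) \<partial>?P) * (\<integral>\<^sup>+x. g (?e x) \<partial>?P) \<le> (\<integral>\<^sup>+x. h (?e x) \<partial>?P)\<^sup>2"
  proof (rule prekopa_leindler_PiM)
    fix x y :: "'a \<Rightarrow> real"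
    have "?e (\<lambda>i\<in>Basis. (x i + y i) / 2) = (\<Sum>b\<in>Basis. ((x b + y b) / 2) *\<^sub>R b)"
      by (intro sum.cong) auto
    also have "\<dots> = (1/2) *\<^sub>R (?e x + ?e y)"
      by (simp add: scaleR_sum_right sum.distrib[symmetric] algebra_simps add_divide_distrib)
    finally show "f (?e x) * g (?e y) \<le> (h (?e (\<lambda>i\<in>Basis. (x i + y i) / 2)))\<^sup>2"
      using h by simp
  qed (use m in \<open>measurable\<close>)
  then show ?thesis using m by (simp add: eq)
qed

lemma midpoint_set:
  fixes A B C :: "'a::euclidean_space set"
  assumes "A \<in> sets borel" "B \<in> sets borel" "C \<in> sets borel"
    and mid: "\<And>x y. x \<in> A \<Longrightarrow> y \<in> B \<Longrightarrow> (1/2) *\<^sub>R (x + y) \<in> C"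
  shows "emeasure lborel A * emeasure lborel B \<le> (emeasure lborel C)\<^sup>2"
proof -
  have "(\<integral>\<^sup>+x. indicator A x \<partial>lborel) * (\<integral>\<^sup>+x. indicator B x \<partial>lborel) \<le> (\<integral>\<^sup>+x. indicator C x \<partial>lborel)\<^sup>2"
    by (rule prekopa_leindler_midpoint) (use assms in \<open>auto simp: indicator_def\<close>)
  then show ?thesis using assms by simp
qed

section \<open>Concavity of the volume of caps\<close>

lemma AE_inner_neq:
  fixes x :: "'a::euclidean_space"
  assumes "x \<noteq> 0 \<or> c \<noteq> 0"
  shows "AE y in lborel. x \<bullet> y \<noteq> c"
proof -
  have "{y. x \<bullet> y = c} \<in> null_sets lebesgue"
    using negligible_hyperplane[OF assms] by (simp add: negligible_iff_null_sets)
  then have "AE y in lebesgue. y \<notin> {y. x \<bullet> y = c}" by (rule AE_not_in)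
  then show ?thesis by (simp add: AE_completion_iff)
qed

text \<open>
  Consider the leftmost minimum. If it is interior, its two neighbours at a small equal distance
  contradict the midpoint inequality, because the left one has a strictly larger value.
\<close>
lemma midpoint_log_concave_ge_one:
  fixes \<phi> :: "real \<Rightarrow> real"
  assumes cont: "continuous_on {0..1} \<phi>"
    and pos: "\<And>u. u \<in> {0..1} \<Longrightarrow> 0 < \<phi> u"
    and mid: "\<And>u v. u \<in> {0..1} \<Longrightarrow> v \<in> {0..1} \<Longrightarrow> \<phi> u * \<phi> v \<le> (\<phi> ((u + v) / 2))\<^sup>2"
    and ends: "1 \<le> \<phi> 0" "1 \<le> \<phi> 1" and u: "u \<in> {0..1}"
  shows "1 \<le> \<phi> u"
proof -
  obtain m where m: "m \<in> {0..1}" "\<And>v. v \<in> {0..1} \<Longrightarrow> \<phi> m \<le> \<phi> v"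
    using continuous_attains_inf[OF compact_Icc _ cont] by fastforce
  define Z where "Z = {v \<in> {0..1}. \<phi> v = \<phi> m}"
  have "closed Z" unfolding Z_def
    by (rule continuous_closed_preimage_constant[OF cont]) simp
  moreover have "bounded Z" by (rule bounded_subset[of "{0..1}"]) (auto simp: Z_def)
  ultimately have "compact Z" by (simp add: compact_eq_bounded_closed)
  moreover have "Z \<noteq> {}" using m by (auto simp: Z_def)
  ultimately obtain z where z: "z \<in> Z" "\<And>v. v \<in> Z \<Longrightarrow> z \<le> v"
    using compact_attains_inf[of Z] by auto
  have zI: "z \<in> {0..1}" "\<phi> z = \<phi> m" using z by (auto simp: Z_def)
  have "1 \<le> \<phi> m"
  proof (cases "z = 0 \<or> z = 1")
    case False
    define d where "d = min z (1 - z)"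
    have d: "0 < d" "z - d \<in> {0..1}" "z + d \<in> {0..1}"
      using False zI by (auto simp: d_def)
    have "z - d \<notin> Z" using z(2)[of "z - d"] d by auto
    then have "\<phi> m < \<phi> (z - d)" using m(2)[OF d(2)] d(2) by (auto simp: Z_def)
    then have "\<phi> m * \<phi> m < \<phi> (z - d) * \<phi> (z + d)"
      using m(2)[OF d(3)] pos[OF m(1)] by (intro mult_less_le_imp_less) auto
    also have "\<dots> \<le> (\<phi> ((z - d + (z + d)) / 2))\<^sup>2" by (rule mid[OF d(2,3)])
    finally show ?thesis using zI by (simp add: power2_eq_square)
  qed (use ends zI in auto)
  then show ?thesis using m(2)[OF u] by simp
qed

text \<open>
  The volume of a cap, which up to normalisation is the tail distribution of \<open>x \<bullet>
  y\<close> for \<open>y\<close> uniform on \<open>L\<close>.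
\<close>
definition tail :: "'a::euclidean_space set \<Rightarrow> 'a \<Rightarrow> real \<Rightarrow> real" where
  "tail L x a = measure lborel (L \<inter> {y. a \<le> x \<bullet> y})"

lemma compact_cap: "compact L \<Longrightarrow> compact (L \<inter> {y::'a::euclidean_space. a \<le> x \<bullet> y})"
  using closed_halfspace_ge[of a x] by (simp add: compact_Int_closed)

lemma emeasure_cap:
  "compact L \<Longrightarrow> emeasure lborel (L \<inter> {y. a \<le> x \<bullet> y}) = ennreal (tail L x a)"
  unfolding tail_def
  using emeasure_compact_finite[OF compact_cap[of L a x]]
  by (intro emeasure_eq_ennreal_measure) (auto simp: less_top)

lemma tail_nonneg: "0 \<le> tail L x a"
  by (simp add: tail_def)

lemma tail_antimono: "compact L \<Longrightarrow> a \<le> b \<Longrightarrow> tail L x b \<le> tail L x a"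
  using emeasure_mono[of "L \<inter> {y. b \<le> x \<bullet> y}" "L \<inter> {y. a \<le> x \<bullet> y}" lborel]
  by (simp add: emeasure_cap tail_nonneg) (force simp: borel_compact compact_cap)

text \<open>
  Dominated convergence: the indicators of the caps converge off the bounding hyperplane, which is a
  null set.
\<close>
lemma continuous_tail:
  fixes L :: "'a::euclidean_space set"
  assumes L: "compact L" and x: "x \<noteq> 0"
  shows "continuous_on S (tail L x)"
proof (rule continuous_at_imp_continuous_on, rule ballI, unfold continuous_at_sequentially comp_def, intro allI impI)
  fix a :: real and u :: "nat \<Rightarrow> real" assume u: "u \<longlonglongrightarrow> a"
  have [measurable]: "L \<in> sets borel" using L by (rule borel_compact)
  let ?i = "\<lambda>a y. indicator (L \<inter> {y. a \<le> x \<bullet> y}) y :: real"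
  have tail_eq: "tail L x b = (\<integral>y. ?i b y \<partial>lborel)" for b
    unfolding tail_def by simp
  have ae: "AE y in lborel. x \<bullet> y \<noteq> a" by (rule AE_inner_neq) (simp add: x)
  show "(\<lambda>n. tail L x (u n)) \<longlonglongrightarrow> tail L x a"
    unfolding tail_eq
  proof (rule integral_dominated_convergence[where w = "indicator L"])
    show "AE y in lborel. (\<lambda>n. ?i (u n) y) \<longlonglongrightarrow> ?i a y"
      using ae
    proof eventually_elim
      case (elim y)
      have "\<forall>\<^sub>F n in sequentially. ?i (u n) y = ?i a y"
      proof (cases "a < x \<bullet> y")
        case True
        then have "\<forall>\<^sub>F n in sequentially. u n < x \<bullet> y" using u order_tendstoD(2) by blast
        then show ?thesis using True by (auto elim!: eventually_mono simp: indicator_def)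
      next
        case False
        then have "x \<bullet> y < a" using elim by simp
        then have "\<forall>\<^sub>F n in sequentially. x \<bullet> y < u n" using u order_tendstoD(1) by blast
        then show ?thesis using False elim by (auto elim!: eventually_mono simp: indicator_def)
      qed
      then show ?case by (rule tendsto_eventually)
    qed
    show "integrable lborel (indicator L :: 'a \<Rightarrow> real)"
      using L emeasure_compact_finite[OF L] by (intro integrable_real_indicator) auto
  qed (auto simp: indicator_def)
qed

lemma emeasure_lborel_scaleR:
  fixes S :: "'a::euclidean_space set"
  assumes "compact S" "0 \<le> c"
  shows "emeasure lborel ((*\<^sub>R) c ` S) = ennreal (c ^ DIM('a)) * emeasure lborel S"
proof -
  have "compact ((*\<^sub>R) c ` S)" by (intro compact_continuous_image assms continuous_intros)
  then show ?thesis
    using emeasure_lebesgue_affine[of c 0 S] assms by (simp add: borel_compact)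
qed

text \<open>
  The volume of the cap of the dilate \<open>c *\<^sub>R L\<close> at height \<open>c a\<close> is
  \<open>c ^ n\<close> times that of the cap of \<open>L\<close> at height \<open>a\<close>.
  Midpoints of two such caps, for different dilates, lie in the corresponding cap of the mean
  dilate. Letting the scale vary with the height is what later upgrades logarithmic concavity to
  concavity of the \<open>n\<close>-th root.
\<close>
lemma tail_midpoint:
  fixes L :: "'a::euclidean_space set"
  assumes L: "compact L" "convex L" and c: "0 < c1" "0 < c2"
  shows "(c1 ^ DIM('a) * tail L x a1) * (c2 ^ DIM('a) * tail L x a2)
       \<le> (((c1 + c2) / 2) ^ DIM('a) * tail L x ((c1 * a1 + c2 * a2) / (c1 + c2)))\<^sup>2"
proof -
  define c a where "c = (c1 + c2) / 2" and "a = (c1 * a1 + c2 * a2) / (c1 + c2)"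
  have cpos: "0 < c" using c by (simp add: c_def)
  let ?A = "\<lambda>c a. (*\<^sub>R) c ` (L \<inter> {y. a \<le> x \<bullet> y})"
  have em: "emeasure lborel (?A c a) = ennreal (c ^ DIM('a) * tail L x a)" if "0 < c" for c a
    using that L by (simp add: emeasure_lborel_scaleR compact_cap emeasure_cap ennreal_mult tail_nonneg)
  have bor: "?A c a \<in> sets borel" for c a
    using L by (intro borel_compact compact_continuous_image compact_cap continuous_intros)
  have "emeasure lborel (?A c1 a1) * emeasure lborel (?A c2 a2) \<le> (emeasure lborel (?A c a))\<^sup>2"
  proof (rule midpoint_set[OF bor bor bor])
    fix y z assume "y \<in> ?A c1 a1" "z \<in> ?A c2 a2"
    then obtain y' z' where y: "y = c1 *\<^sub>R y'" "y' \<in> L" "a1 \<le> x \<bullet> y'"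
      and z: "z = c2 *\<^sub>R z'" "z' \<in> L" "a2 \<le> x \<bullet> z'" by auto
    define w where "w = (c1 / (c1 + c2)) *\<^sub>R y' + (c2 / (c1 + c2)) *\<^sub>R z'"
    have "w \<in> L" unfolding w_def using c y z
      by (intro convexD[OF L(2)]) (auto simp: add_divide_distrib[symmetric])
    moreover have "a \<le> x \<bullet> w"
    proof -
      have "a = (c1 / (c1 + c2)) * a1 + (c2 / (c1 + c2)) * a2"
        by (simp add: a_def add_divide_distrib)
      also have "\<dots> \<le> (c1 / (c1 + c2)) * (x \<bullet> y') + (c2 / (c1 + c2)) * (x \<bullet> z')"
        using c y z by (intro add_mono mult_left_mono) auto
      finally show ?thesis by (simp add: w_def inner_add_right)
    qed
    moreover have "(1/2) *\<^sub>R (y + z) = c *\<^sub>R w"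
    proof -
      have *: "c * (c1 / (c1 + c2)) = c1 / 2" "c * (c2 / (c1 + c2)) = c2 / 2"
        using c by (auto simp: c_def field_simps)
      show ?thesis unfolding w_def y z scaleR_add_right scaleR_scaleR * by simp
    qed
    ultimately show "(1/2) *\<^sub>R (y + z) \<in> ?A c a" by auto
  qed
  then have "ennreal ((c1 ^ DIM('a) * tail L x a1) * (c2 ^ DIM('a) * tail L x a2))
     \<le> ennreal ((c ^ DIM('a) * tail L x a)\<^sup>2)"
    using c cpos by (simp add: em ennreal_mult[symmetric] ennreal_power tail_nonneg)
  then show ?thesis by (simp add: c_def a_def)
qed

text \<open>
  Dilate the two caps to volume 1. Along the segment between the two pairs of scale and height, the
  volume of the dilated cap is log-concave, so it stays at least 1; undoing the dilation at the
  right intermediate point gives the claim.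
\<close>
lemma root_tail_concave:
  fixes L :: "'a::euclidean_space set"
  assumes L: "compact L" "convex L" and x: "x \<noteq> 0"
    and pos: "0 < tail L x a1" "0 < tail L x a2" and \<theta>: "0 \<le> \<theta>" "\<theta> \<le> 1"
  shows "(1 - \<theta>) * root DIM('a) (tail L x a1) + \<theta> * root DIM('a) (tail L x a2)
       \<le> root DIM('a) (tail L x ((1 - \<theta>) * a1 + \<theta> * a2))"
proof -
  let ?n = "DIM('a)"
  define b1 b2 where "b1 = root ?n (tail L x a1)" and "b2 = root ?n (tail L x a2)"
  have b: "0 < b1" "0 < b2" "b1 ^ ?n = tail L x a1" "b2 ^ ?n = tail L x a2"
    using pos by (auto simp: b1_def b2_def)
  define \<kappa> where "\<kappa> = (1 - \<theta>) * b1 + \<theta> * b2"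
  have \<kappa>: "0 < \<kappa>"
    using \<theta> b by (cases "\<theta> = 0") (auto simp: \<kappa>_def intro!: add_nonneg_pos)
  (* Scale and height along the segment joining the two caps of volume 1. *)
  define c where "c u = (1 - u) / b1 + u / b2" for u
  define d where "d u = (1 - u) / b1 * a1 + u / b2 * a2" for u
  have cpos: "0 < c u" if "u \<in> {0..1}" for u
    using that b by (cases "u = 0") (auto simp: c_def intro!: add_nonneg_pos)
  define \<phi> where "\<phi> u = c u ^ ?n * tail L x (d u / c u)" for u
  (* At this parameter the ratio of height to scale is the given convex combination of a1 and a2. *)
  have ge1: "1 \<le> \<phi> (\<theta> * b2 / \<kappa>)"
  proof (rule midpoint_log_concave_ge_one[where \<phi> = \<phi>])
    have "continuous_on {0..1} c" "continuous_on {0..1} d"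
      unfolding c_def d_def using b by (auto intro!: continuous_intros)
    then have "continuous_on {0..1} (\<lambda>u. d u / c u)"
      using cpos by (intro continuous_on_divide) force+
    then have "continuous_on {0..1} (\<lambda>u. tail L x (d u / c u))"
      by (rule continuous_on_compose2[OF continuous_tail[OF L(1) x, of UNIV]]) simp
    then show "continuous_on {0..1} \<phi>"
      unfolding \<phi>_def by (intro continuous_intros) (use b in \<open>auto simp: c_def intro!: continuous_intros\<close>)
    show "0 < \<phi> u" if u: "u \<in> {0..1}" for u
    proof -
      have "d u \<le> (1 - u) / b1 * max a1 a2 + u / b2 * max a1 a2"
        unfolding d_def using u b by (intro add_mono mult_left_mono) auto
      also have "\<dots> = c u * max a1 a2" by (simp add: c_def distrib_right)
      finally have "d u / c u \<le> max a1 a2" using cpos[OF u] by (simp add: pos_divide_le_eq mult.commute)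
      then have "tail L x (max a1 a2) \<le> tail L x (d u / c u)" by (rule tail_antimono[OF L(1)])
      then have "0 < tail L x (d u / c u)" using pos by (auto simp: max_def split: if_splits)
      then show ?thesis using cpos[OF u] by (simp add: \<phi>_def)
    qed
    show "\<phi> u * \<phi> v \<le> (\<phi> ((u + v) / 2))\<^sup>2" if u: "u \<in> {0..1}" and v: "v \<in> {0..1}" for u v
    proof -
      have c2: "(c u + c v) / 2 = c ((u + v) / 2)" and d2: "(d u + d v) / 2 = d ((u + v) / 2)"
        using b by (auto simp: c_def d_def field_simps)
      have "(c u * (d u / c u) + c v * (d v / c v)) / (c u + c v) = ((d u + d v) / 2) / ((c u + c v) / 2)"
        using cpos[OF u] cpos[OF v] by (simp add: field_simps)
      then show ?thesis
        using tail_midpoint[OF L cpos[OF u] cpos[OF v], of x "d u / c u" "d v / c v"]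
        unfolding \<phi>_def c2 d2 by simp
    qed
    show "1 \<le> \<phi> 0" "1 \<le> \<phi> 1"
      using b by (auto simp: \<phi>_def c_def d_def power_divide)
    show "\<theta> * b2 / \<kappa> \<in> {0..1}"
      using \<theta> b \<kappa> by (auto simp: \<kappa>_def)
  qed
  have ceq: "c (\<theta> * b2 / \<kappa>) = 1 / \<kappa>"
  proof -
    have "1 - \<theta> * b2 / \<kappa> = (1 - \<theta>) * b1 / \<kappa>" using \<kappa> by (simp add: field_simps \<kappa>_def)
    then show ?thesis using b \<kappa> unfolding c_def by (simp add: field_simps)
  qed
  have deq: "d (\<theta> * b2 / \<kappa>) = ((1 - \<theta>) * a1 + \<theta> * a2) / \<kappa>"
  proof -
    have "1 - \<theta> * b2 / \<kappa> = (1 - \<theta>) * b1 / \<kappa>" using \<kappa> by (simp add: field_simps \<kappa>_def)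
    then have "(1 - \<theta> * b2 / \<kappa>) / b1 = (1 - \<theta>) / \<kappa>" "\<theta> * b2 / \<kappa> / b2 = \<theta> / \<kappa>"
      using b by auto
    then show ?thesis unfolding d_def by (simp add: add_divide_distrib)
  qed
  have "1 \<le> tail L x ((1 - \<theta>) * a1 + \<theta> * a2) / \<kappa> ^ ?n"
    using ge1 ceq deq \<kappa> by (simp add: \<phi>_def power_divide)
  then have "\<kappa> ^ ?n \<le> tail L x ((1 - \<theta>) * a1 + \<theta> * a2)"
    using \<kappa> by simp
  then have "root ?n (\<kappa> ^ ?n) \<le> root ?n (tail L x ((1 - \<theta>) * a1 + \<theta> * a2))"
    by (simp add: real_root_le_iff)
  moreover have "root ?n (\<kappa> ^ ?n) = \<kappa>" using \<kappa> by (intro real_root_power_cancel) auto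
  ultimately have "\<kappa> \<le> root ?n (tail L x ((1 - \<theta>) * a1 + \<theta> * a2))" by simp
  then show ?thesis unfolding \<kappa>_def b1_def b2_def .
qed

section \<open>Integrals of functions of a linear functional\<close>

text \<open>
  Layer-cake formula: write \<open>h (x \<bullet> y) - h p\<close> as the integral of
  \<open>k\<close> from \<open>p\<close> to \<open>x \<bullet> y\<close> and exchange the integrals.
\<close>
lemma integral_tail:
  fixes L :: "'a::euclidean_space set"
  assumes L: "compact L" and x: "x \<noteq> 0" and pB: "\<And>y. y \<in> L \<Longrightarrow> x \<bullet> y \<in> {p..B}"
    and h: "\<And>a. a \<in> {p..B} \<Longrightarrow> (h has_real_derivative k a) (at a)"
    and k: "continuous_on {p..B} k" "\<And>a. a \<in> {p..B} \<Longrightarrow> 0 \<le> k a"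
  shows "(LINT y:L|lborel. h (x \<bullet> y)) = h p * measure lborel L + integral {p..B} (\<lambda>a. k a * tail L x a)"
proof -
  have [measurable]: "L \<in> sets borel" using L by (rule borel_compact)
  have cL: "emeasure lborel L < \<infinity>" by (rule emeasure_compact_finite[OF L])
  define k' where "k' a = indicator {p..B} a * k a" for a
  have k'm [measurable]: "k' \<in> borel_measurable borel"
    using borel_measurable_continuous_on_indicator[OF _ k(1)] by (simp add: k'_def[abs_def])
  have k'0: "0 \<le> k' a" for a using k(2) by (simp add: k'_def indicator_def)
  have hcont: "continuous_on {p..B} h"
    by (intro continuous_at_imp_continuous_on ballI DERIV_isCont[OF h])
  have hx: "continuous_on L (\<lambda>y. h (x \<bullet> y))"
    by (rule continuous_on_compose2[OF hcont]) (use pB in \<open>auto intro!: continuous_intros\<close>)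
  have hmono: "h p \<le> h (x \<bullet> y)" if "y \<in> L" for y
    using pB[OF that] by (intro DERIV_nonneg_imp_nondecreasing[of p "x \<bullet> y" h]) (use h k(2) in force)+
  have int1: "integrable lborel (\<lambda>y. indicator L y * (h (x \<bullet> y) - h p))"
    using borel_integrable_compact[OF L continuous_on_diff[OF hx continuous_on_const[of L "h p"]]]
    by simp
  have int2: "integrable lborel (\<lambda>y. indicator L y * h (x \<bullet> y))"
    using borel_integrable_compact[OF L hx] by simp
  have int3: "integrable lborel (\<lambda>y. indicator L y * h p)"
    using borel_integrable_compact[OF L, of "\<lambda>y. h p"] by simp
  have "ennreal (\<integral>y. indicator L y * (h (x \<bullet> y) - h p) \<partial>lborel)
      = (\<integral>\<^sup>+y. ennreal (indicator L y * (h (x \<bullet> y) - h p)) \<partial>lborel)"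
    using hmono by (intro nn_integral_eq_integral[symmetric] int1) (auto simp: indicator_def)
  also have "\<dots> = (\<integral>\<^sup>+y. \<integral>\<^sup>+a. indicator L y * (indicator {p..} a * (ennreal (k' a) * indicator {..x \<bullet> y} a)) \<partial>lborel \<partial>lborel)"
  proof (intro nn_integral_cong)
    fix y :: 'a
    show "ennreal (indicator L y * (h (x \<bullet> y) - h p))
       = (\<integral>\<^sup>+a. indicator L y * (indicator {p..} a * (ennreal (k' a) * indicator {..x \<bullet> y} a)) \<partial>lborel)"
    proof (cases "y \<in> L")
      case True
      have "(\<integral>\<^sup>+a. indicator {p..} a * (ennreal (k' a) * indicator {..x \<bullet> y} a) \<partial>lborel)
          = (\<integral>\<^sup>+a. ennreal (k' a) * indicator {p..x \<bullet> y} a \<partial>lborel)"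
        by (intro nn_integral_cong) (auto simp: indicator_def)
      also have "\<dots> = ennreal (h (x \<bullet> y) - h p)"
      proof (rule nn_integral_FTC_Icc[OF k'm, where F = h])
        show "(h has_real_derivative k' a) (at a)" if "a \<in> {p..x \<bullet> y}" for a
        proof -
          have "a \<in> {p..B}" using that pB[OF True] by auto
          then show ?thesis using h[of a] by (simp add: k'_def)
        qed
      qed (use k'0 pB[OF True] in auto)
      finally show ?thesis using True by simp
    qed simp
  qed
  also have "\<dots> = (\<integral>\<^sup>+a. \<integral>\<^sup>+y. indicator L y * (indicator {p..} a * (ennreal (k' a) * indicator {..x \<bullet> y} a)) \<partial>lborel \<partial>lborel)"
  proof (rule lborel_pair.Fubini')
    have "(\<lambda>(a, y). indicator L y * (indicator {p..} a * (ennreal (k' a) * indicator {..x \<bullet> y} a)))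
        = (\<lambda>z. indicator L (snd z) * (indicator {p..} (fst z) * (ennreal (k' (fst z)) * indicator {z. fst z \<le> x \<bullet> snd z} z)))"
      by (auto simp: fun_eq_iff indicator_def)
    also have "\<dots> \<in> borel_measurable (lborel \<Otimes>\<^sub>M lborel)" by measurable
    finally show "(\<lambda>(a, y). indicator L y * (indicator {p..} a * (ennreal (k' a) * indicator {..x \<bullet> y} a)))
       \<in> borel_measurable (lborel \<Otimes>\<^sub>M lborel)" .
  qed
  also have "\<dots> = (\<integral>\<^sup>+a. ennreal (indicator {p..B} a * (k a * tail L x a)) \<partial>lborel)"
  proof (intro nn_integral_cong)
    fix a :: real
    have "(\<integral>\<^sup>+y. indicator L y * (indicator {p..} a * (ennreal (k' a) * indicator {..x \<bullet> y} a)) \<partial>lborel)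
        = (\<integral>\<^sup>+y. ennreal (k' a) * indicator (L \<inter> {y. a \<le> x \<bullet> y}) y \<partial>lborel)"
      by (intro nn_integral_cong) (auto simp: indicator_def k'_def)
    also have "\<dots> = ennreal (k' a) * emeasure lborel (L \<inter> {y. a \<le> x \<bullet> y})"
      by (subst nn_integral_cmult_indicator) auto
    also have "\<dots> = ennreal (indicator {p..B} a * (k a * tail L x a))"
      using L k'0[of a] by (simp add: emeasure_cap ennreal_mult[symmetric] tail_nonneg k'_def mult.assoc)
    finally show "(\<integral>\<^sup>+y. indicator L y * (indicator {p..} a * (ennreal (k' a) * indicator {..x \<bullet> y} a)) \<partial>lborel)
        = ennreal (indicator {p..B} a * (k a * tail L x a))" .
  qed
  also have "\<dots> = ennreal (integral {p..B} (\<lambda>a. k a * tail L x a))"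
  proof -
    have c: "continuous_on {p..B} (\<lambda>a. k a * tail L x a)"
      by (intro continuous_intros k continuous_tail L x)
    have i: "set_integrable lborel {p..B} (\<lambda>a. k a * tail L x a)"
      by (rule borel_integrable_atLeastAtMost'[OF c])
    show ?thesis
      unfolding set_borel_integral_eq_integral(2)[OF i, symmetric] set_lebesgue_integral_def
      using i k(2) by (subst nn_integral_eq_integral) (auto simp: set_integrable_def indicator_def tail_nonneg)
  qed
  finally have "(\<integral>y. indicator L y * (h (x \<bullet> y) - h p) \<partial>lborel) = integral {p..B} (\<lambda>a. k a * tail L x a)"
    using hmono k(2)
    by (subst (asm) ennreal_inj) (auto intro!: integral_nonneg_AE Henstock_Kurzweil_Integration.integral_nonneg
        integrable_continuous_interval continuous_intros k continuous_tail L x simp: tail_nonneg indicator_def)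
  moreover have "(\<integral>y. indicator L y * (h (x \<bullet> y) - h p) \<partial>lborel)
      = (\<integral>y. indicator L y * h (x \<bullet> y) \<partial>lborel) - (\<integral>y. indicator L y * h p \<partial>lborel)"
    using int2 int3 by (simp add: right_diff_distrib)
  moreover have "(\<integral>y. indicator L y * h p \<partial>lborel) = h p * measure lborel L"
    by simp
  ultimately show ?thesis by (simp add: set_lebesgue_integral_def algebra_simps)
qed

text \<open>
  Subtract from \<open>k\<close> the secant through the end points of the interval on which
  \<open>D\<close> is positive. This does not change the integral, as \<open>D\<close> is orthogonal
  to affine functions, and by convexity it makes the integrand nonpositive everywhere.
\<close>
lemma integral_mult_convex_nonpos:
  fixes D k :: "real \<Rightarrow> real"
  assumes D: "continuous_on {p..B} D" and k: "continuous_on {p..B} k" "convex_on {p..B} k"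
      "\<And>a. a \<in> {p..B} \<Longrightarrow> 0 \<le> k a"
    and interval: "\<And>u w v. p \<le> u \<Longrightarrow> u < w \<Longrightarrow> w < v \<Longrightarrow> v \<le> B \<Longrightarrow> 0 < D u \<Longrightarrow> 0 < D v \<Longrightarrow> 0 < D w"
    and zero: "integral {p..B} D = 0" "integral {p..B} (\<lambda>a. a * D a) = 0"
  shows "integral {p..B} (\<lambda>a. k a * D a) \<le> 0"
proof -
  have int: "(\<lambda>a. f a * D a) integrable_on {p..B}" if "continuous_on {p..B} f" for f
    by (intro integrable_continuous_interval continuous_intros that D)
  define P where "P = {a \<in> {p..B}. 0 < D a}"
  define z1 z2 where "z1 = Inf P" and "z2 = Sup P"
  show ?thesis
  proof (cases "\<exists>u\<in>P. \<exists>v\<in>P. u < v")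
    case False
    then obtain c where c: "P \<subseteq> {c}" by (metis (no_types) empty_subsetI insert_iff linorder_neqE subsetI)
    have "integral {p..B} (\<lambda>a. k a * D a) = integral {p..B} (\<lambda>a. if a = c then 0 else k a * D a)"
      by (rule integral_spike[of "{c}"]) auto
    also have "\<dots> \<le> integral {p..B} (\<lambda>a. 0)"
    proof (rule integral_le)
      show "(\<lambda>a. if a = c then 0 else k a * D a) integrable_on {p..B}"
        by (rule integrable_spike[OF int[OF k(1)], of "{c}"]) auto
      show "(if a = c then 0 else k a * D a) \<le> 0" if "a \<in> {p..B}" for a
      proof (cases "a = c")
        case False
        then have "a \<notin> P" using c by auto
        then show ?thesis using that k(3)[OF that] by (simp add: P_def mult_nonneg_nonpos)
      qed simp
    qed (rule integrable_0)
    finally show ?thesis by simp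
  next
    case True
    then obtain u v where uv: "u \<in> P" "v \<in> P" "u < v" by blast
    have bdd: "bdd_below P" "bdd_above P" by (auto simp: P_def intro: bdd_belowI[of _ p] bdd_aboveI[of _ B])
    have z: "z1 \<le> u" "v \<le> z2" unfolding z1_def z2_def using uv bdd by (auto intro: cInf_lower cSup_upper)
    then have z12: "z1 < z2" using uv by simp
    have zI: "p \<le> z1" "z2 \<le> B"
      unfolding z1_def z2_def using uv by (auto intro!: cInf_greatest cSup_least simp: P_def)
    have out: "D a \<le> 0" if "a \<in> {p..B}" "a < z1 \<or> z2 < a" for a
    proof (rule ccontr)
      assume "\<not> D a \<le> 0"
      then have "a \<in> P" using that by (auto simp: P_def)
      then have "z1 \<le> a" "a \<le> z2" unfolding z1_def z2_def using bdd by (auto intro: cInf_lower cSup_upper)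
      then show False using that by auto
    qed
    have inside: "0 < D a" if za: "z1 < a" "a < z2" for a
    proof -
      have ne: "P \<noteq> {}" using uv by auto
      obtain u' where "u' \<in> P" "u' < a" using cInf_lessD[OF ne za(1)[unfolded z1_def]] by auto
      moreover obtain v' where "v' \<in> P" "a < v'" using less_cSupD[OF ne za(2)[unfolded z2_def]] by auto
      ultimately show ?thesis using interval[of u' a v'] by (auto simp: P_def)
    qed
    define m where "m = (k z2 - k z1) / (z2 - z1)"
    define l where "l a = m * (a - z1) + k z1" for a
    have conv: "convex_on {a..b} k" if "p \<le> a" "b \<le> B" for a b
      using that by (intro convex_on_subset[OF k(2)]) auto
    have sign: "(k a - l a) * D a \<le> 0" if a: "a \<in> {p..B}" for a
    proof -
      consider "a < z1" | "a = z1" | "a = z2" | "z2 < a" | "z1 < a" "a < z2" by linarith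
      then show ?thesis
      proof cases
        case 1
        have "k z1 \<le> (k z2 - k a) / (z2 - a) * (z1 - a) + k a"
          using convex_onD_Icc'[OF conv[of a z2], of z1] 1 a zI z12 by auto
        then have "(k z1 - k a) * (z2 - a) \<le> (k z2 - k a) * (z1 - a)"
          using 1 z12 by (simp add: field_simps)
        then have "(k z2 - k z1) * (a - z1) \<le> (k a - k z1) * (z2 - z1)"
          by (simp add: algebra_simps)
        then have "l a \<le> k a" using z12 by (simp add: l_def m_def field_simps)
        then show ?thesis using out[OF a] 1 by (intro mult_nonneg_nonpos) auto
      next
        case 4
        have "k z2 \<le> (k a - k z1) / (a - z1) * (z2 - z1) + k z1"
          using convex_onD_Icc'[OF conv[of z1 a], of z2] 4 a zI z12 by auto
        then have "(k z2 - k z1) * (a - z1) \<le> (k a - k z1) * (z2 - z1)"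
          using 4 z12 by (simp add: field_simps)
        then have "l a \<le> k a" using z12 by (simp add: l_def m_def field_simps)
        then show ?thesis using out[OF a] 4 by (intro mult_nonneg_nonpos) auto
      next
        case 5
        have "k a \<le> l a"
          using convex_onD_Icc'[OF conv[of z1 z2], of a] 5 zI by (auto simp: l_def m_def)
        then show ?thesis using inside[OF 5] by (intro mult_nonpos_nonneg) auto
      qed (use z12 in \<open>auto simp: l_def m_def\<close>)
    qed
    have "integral {p..B} (\<lambda>a. (k a - l a) * D a) \<le> integral {p..B} (\<lambda>a. 0)"
      by (rule integral_le) (use sign in \<open>auto simp: l_def intro!: int continuous_intros k\<close>)
    moreover have "integral {p..B} (\<lambda>a. (k a - l a) * D a)
        = integral {p..B} (\<lambda>a. k a * D a) - integral {p..B} (\<lambda>a. l a * D a)"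
      unfolding left_diff_distrib
      by (rule integral_diff) (auto simp: l_def intro!: int continuous_intros k)
    moreover have "integral {p..B} (\<lambda>a. l a * D a) = 0"
    proof -
      have eq: "l a * D a = m * (a * D a) + (k z1 - m * z1) * D a" for a
        by (simp add: l_def algebra_simps)
      have "(\<lambda>a. m * (a * D a)) integrable_on {p..B}" "(\<lambda>a. (k z1 - m * z1) * D a) integrable_on {p..B}"
        by (auto intro!: integrable_continuous_interval continuous_intros D)
      then show ?thesis unfolding eq by (simp add: integral_add zero)
    qed
    ultimately show ?thesis by simp
  qed
qed

section \<open>The comparison cone\<close>

text \<open>
  The functional has mean zero on a cone of dimension \<open>n\<close> if its base lies at level
  \<open>- r / n\<close> and its apex at level \<open>r\<close>; the height of that cone is \<open>r
  + r / n\<close>.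
\<close>
definition cone_height :: "nat \<Rightarrow> real \<Rightarrow> real" where
  "cone_height n r = (real n + 1) * r / real n"

text \<open>
  The linear scale of the section at level \<open>a\<close> relative to the base, continued affinely
  beyond base and apex.
\<close>
definition cone_slope :: "nat \<Rightarrow> real \<Rightarrow> real \<Rightarrow> real" where
  "cone_slope n r a = (r - a) / cone_height n r"

text \<open>
  The fraction of the volume of the cone above level \<open>a\<close>; the truncations make it 1
  below the base and 0 above the apex.
\<close>
definition cone_tail :: "nat \<Rightarrow> real \<Rightarrow> real \<Rightarrow> real" where
  "cone_tail n r a = (min 1 (max 0 (cone_slope n r a))) ^ n"

lemma cone_height_pos: "0 < r \<Longrightarrow> 0 < n \<Longrightarrow> 0 < cone_height n r"
  by (simp add: cone_height_def add_nonneg_pos)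

lemma continuous_cone_tail: "continuous_on S (cone_tail n r)"
  unfolding cone_tail_def cone_slope_def divide_inverse by (intro continuous_intros)

lemma cone_height_split: "0 < n \<Longrightarrow> cone_height n r = r + r / real n"
  by (simp add: cone_height_def field_simps)

lemma cone_slope_base: "0 < r \<Longrightarrow> 0 < n \<Longrightarrow> cone_slope n r (- (r / real n)) = 1"
  using cone_height_pos[of r n] by (simp add: cone_slope_def cone_height_split)

lemma cone_slope_apex [simp]: "cone_slope n r r = 0"
  by (simp add: cone_slope_def)

lemma cone_slope_antimono:
  "0 < r \<Longrightarrow> a \<le> b \<Longrightarrow> cone_slope n r b \<le> cone_slope n r a"
  unfolding cone_slope_def cone_height_def by (intro divide_right_mono) auto

lemma cone_tail_nonneg: "0 \<le> cone_tail n r a"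
  by (simp add: cone_tail_def)

lemma cone_tail_le: "cone_tail n r a \<le> (max 0 (cone_slope n r a)) ^ n"
  unfolding cone_tail_def by (intro power_mono) auto

lemma cone_tail_below: "0 < r \<Longrightarrow> 0 < n \<Longrightarrow> a \<le> - r / real n \<Longrightarrow> cone_tail n r a = 1"
  using cone_slope_antimono[of r a "- r / real n" n] cone_slope_base[of r n] by (simp add: cone_tail_def)

lemma cone_tail_above: "0 < r \<Longrightarrow> 0 < n \<Longrightarrow> r \<le> a \<Longrightarrow> cone_tail n r a = 0"
  using cone_slope_antimono[of r r a n] by (simp add: cone_tail_def)

lemma cone_tail_right_of_base:
  "0 < r \<Longrightarrow> 0 < n \<Longrightarrow> - r / real n \<le> a \<Longrightarrow> cone_tail n r a = (max 0 (cone_slope n r a)) ^ n"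
  using cone_slope_antimono[of r "- r / real n" a n] cone_slope_base[of r n] by (simp add: cone_tail_def)

lemma cone_tail_between:
  "0 < r \<Longrightarrow> 0 < n \<Longrightarrow> - r / real n \<le> a \<Longrightarrow> a \<le> r \<Longrightarrow> cone_tail n r a = (cone_slope n r a) ^ n"
  using cone_slope_antimono[of r a r n] by (simp add: cone_tail_right_of_base)

lemma DERIV_cone_slope_power:
  assumes "0 < r" "0 < n"
  shows "((\<lambda>a. c * cone_slope n r a ^ Suc j) has_real_derivative
     - (c * real (Suc j) / cone_height n r) * cone_slope n r a ^ j) (at a)"
proof -
  have "(cone_slope n r has_real_derivative - (1 / cone_height n r)) (at a)"
    unfolding cone_slope_def[abs_def] using cone_height_pos[OF assms]
    by (auto intro!: derivative_eq_intros)
  from DERIV_cmult[OF DERIV_power[OF this, of "Suc j"], of c] show ?thesis by (simp add: mult_ac)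
qed

lemma DERIV_cone_first_moment:
  assumes r: "0 < r" and n: "0 < n"
  shows "((\<lambda>a. - (cone_height n r * r / (real n + 1)) * cone_slope n r a ^ Suc n
      + ((cone_height n r)\<^sup>2 / (real n + 2)) * cone_slope n r a ^ Suc (Suc n))
    has_real_derivative a * cone_slope n r a ^ n) (at a)"
proof -
  define R where "R = cone_height n r"
  have R: "0 < R" using cone_height_pos[OF r n] by (simp add: R_def)
  have e: "real n + 1 = real (Suc n)" by simp
  have aeq: "a = r - R * cone_slope n r a" using R by (simp add: cone_slope_def R_def[symmetric])
  have 1: "((\<lambda>a. - (R * r / (real n + 1)) * cone_slope n r a ^ Suc n) has_real_derivative r * cone_slope n r a ^ n) (at a)"
  proof -
    have "- (- (R * r / (real n + 1)) * real (Suc n) / cone_height n r) = r"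
      unfolding e R_def[symmetric] using R by (simp del: of_nat_Suc)
    then show ?thesis using DERIV_cone_slope_power[OF r n, of "- (R * r / (real n + 1))" n a] by metis
  qed
  have 2: "((\<lambda>a. (R\<^sup>2 / (real n + 2)) * cone_slope n r a ^ Suc (Suc n)) has_real_derivative - R * cone_slope n r a ^ Suc n) (at a)"
  proof -
    have e2: "real n + 2 = real (Suc (Suc n))" by simp
    have "- (R\<^sup>2 / (real n + 2) * real (Suc (Suc n)) / cone_height n r) = - R"
      unfolding e2 R_def[symmetric] using R by (simp add: power2_eq_square del: of_nat_Suc)
    then show ?thesis using DERIV_cone_slope_power[OF r n, of "R\<^sup>2 / (real n + 2)" "Suc n" a] by metis
  qed
  have "r * cone_slope n r a ^ n + - R * cone_slope n r a ^ Suc n = a * cone_slope n r a ^ n"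
    by (subst (3) aeq) (simp add: algebra_simps)
  with DERIV_add[OF 1 2] show ?thesis by (simp add: R_def)
qed

text \<open>
  The integral splits at the base and at the apex; only the middle part sees the power of the slope.
\<close>
lemma cone_tail_integral:
  assumes r: "0 < r" and n: "0 < n" and p: "p \<le> - r / real n" and B: "r \<le> B"
    and H: "\<And>a. a \<in> {p..- r / real n} \<Longrightarrow> (H has_real_derivative k a) (at a)"
    and F: "\<And>a. a \<in> {- r / real n..r} \<Longrightarrow> (F has_real_derivative k a * cone_slope n r a ^ n) (at a)"
  shows "((\<lambda>a. k a * cone_tail n r a) has_integral (H (- r / real n) - H p + (F r - F (- r / real n)))) {p..B}"
proof -
  let ?b = "- r / real n"
  have "0 \<le> r / real n" using r by simp
  then have br: "?b \<le> r" using r by linarith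
  have "(k has_integral (H ?b - H p)) {p..?b}"
    by (rule fundamental_theorem_of_calculus[OF p])
       (use H in \<open>auto simp: has_real_derivative_iff_has_vector_derivative[symmetric] intro: has_field_derivative_at_within\<close>)
  then have 1: "((\<lambda>a. k a * cone_tail n r a) has_integral (H ?b - H p)) {p..?b}"
    by (rule has_integral_eq[rotated]) (use r n in \<open>auto simp: cone_tail_below\<close>)
  have "((\<lambda>a. k a * cone_slope n r a ^ n) has_integral (F r - F ?b)) {?b..r}"
    by (rule fundamental_theorem_of_calculus[OF br])
       (use F in \<open>auto simp: has_real_derivative_iff_has_vector_derivative[symmetric] intro: has_field_derivative_at_within\<close>)
  then have 2: "((\<lambda>a. k a * cone_tail n r a) has_integral (F r - F ?b)) {?b..r}"
    by (rule has_integral_eq[rotated]) (use r n in \<open>auto simp: cone_tail_between\<close>)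
  have 3: "((\<lambda>a. k a * cone_tail n r a) has_integral 0) {r..B}"
    by (rule has_integral_eq[of _ "\<lambda>a. 0"]) (use r n in \<open>auto simp: cone_tail_above\<close>)
  have "((\<lambda>a. k a * cone_tail n r a) has_integral (H ?b - H p + (F r - F ?b))) {p..r}"
    by (rule has_integral_combine[OF p br 1 2])
  from has_integral_combine[OF _ B this 3] show ?thesis using p br by simp
qed

text \<open>
  By the layer-cake formula these two integrals say that the functional has mean 0 and mean square
  \<open>r\<^sup>2 / (n (n + 2))\<close> on the cone.
\<close>
lemma cone_tail_moments:
  assumes r: "0 < r" and n: "0 < n" and p: "p \<le> - r / real n" and B: "r \<le> B"
  shows "(cone_tail n r has_integral - p) {p..B}"
    and "((\<lambda>a. a * cone_tail n r a) has_integral (r\<^sup>2 / (real n * (real n + 2)) - p\<^sup>2) / 2) {p..B}"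
proof -
  define R where "R = cone_height n r"
  have R: "0 < R" using cone_height_pos[OF r n] by (simp add: R_def)
  have R_eq: "R = (real n + 1) * r / real n" by (simp add: R_def cone_height_def)
  have "((\<lambda>a. 1 * cone_tail n r a) has_integral
      (- r / real n - p + (- (R / (real n + 1)) * cone_slope n r r ^ Suc n - - (R / (real n + 1)) * cone_slope n r (- r / real n) ^ Suc n))) {p..B}"
  proof (rule cone_tail_integral[OF r n p B, where H = "\<lambda>a. a"])
    show "((\<lambda>a. - (R / (real n + 1)) * cone_slope n r a ^ Suc n) has_real_derivative 1 * cone_slope n r a ^ n) (at a)" for a
    proof -
      have e: "real n + 1 = real (Suc n)" by simp
      have "- (- (R / (real n + 1)) * real (Suc n) / cone_height n r) = 1"
        unfolding e R_def[symmetric] using R by (simp del: of_nat_Suc)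
      then show ?thesis using DERIV_cone_slope_power[OF r n, of "- (R / (real n + 1))" n a] by metis
    qed
  qed (auto intro!: derivative_eq_intros)
  then show "(cone_tail n r has_integral - p) {p..B}"
    using r n by (simp add: cone_slope_base R_eq)
  let ?F = "\<lambda>a. - (R * r / (real n + 1)) * cone_slope n r a ^ Suc n + (R\<^sup>2 / (real n + 2)) * cone_slope n r a ^ Suc (Suc n)"
  have "((\<lambda>a. a * cone_tail n r a) has_integral
      ((- r / real n)\<^sup>2 / 2 - p\<^sup>2 / 2 + (?F r - ?F (- r / real n)))) {p..B}"
  proof (rule cone_tail_integral[OF r n p B, where H = "\<lambda>a. a\<^sup>2 / 2"])
    show "(?F has_real_derivative a * cone_slope n r a ^ n) (at a)" for a
      using DERIV_cone_first_moment[OF r n, of a] by (simp only: R_def)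
  qed (auto intro!: derivative_eq_intros)
  moreover have "(- r / real n)\<^sup>2 / 2 - p\<^sup>2 / 2 + (?F r - ?F (- r / real n)) = (r\<^sup>2 / (real n * (real n + 2)) - p\<^sup>2) / 2"
  proof -
    have "real n + 1 \<noteq> 0" using of_nat_0_le_iff[of n] by linarith
    then have "R * r / (real n + 1) = r\<^sup>2 / real n" by (simp add: R_eq power2_eq_square)
    moreover have "R\<^sup>2 / (real n + 2) = (real n + 1)\<^sup>2 * r\<^sup>2 / ((real n)\<^sup>2 * (real n + 2))"
      by (simp add: R_eq power_divide power_mult_distrib)
    moreover have "(r / real n)\<^sup>2 / 2 + r\<^sup>2 / real n - (real n + 1)\<^sup>2 * r\<^sup>2 / ((real n)\<^sup>2 * (real n + 2)) = r\<^sup>2 / (real n * (real n + 2)) / 2"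
      using n by (simp add: divide_simps) (simp add: power2_eq_square algebra_simps)
    ultimately show ?thesis using r n by (simp add: cone_slope_base power_divide diff_divide_distrib)
  qed
  ultimately show "((\<lambda>a. a * cone_tail n r a) has_integral (r\<^sup>2 / (real n * (real n + 2)) - p\<^sup>2) / 2) {p..B}"
    by (simp only:)
qed

section \<open>Comparison of a centred body with the cone\<close>

lemma measure_convex_body_pos:
  fixes L :: "'a::euclidean_space set"
  assumes "convex_body L"
  shows "0 < measure lborel L"
proof -
  have L: "compact L" "interior L \<noteq> {}" using assms by (auto simp: convex_body_def)
  have "\<not> negligible (interior L)" using L(2) by (intro open_not_negligible) auto
  then have "\<not> negligible L" using interior_subset negligible_subset by blast
  then have "L \<notin> null_sets lebesgue" by (simp add: negligible_iff_null_sets)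
  then have "emeasure lborel L \<noteq> 0" using L(1) by (auto simp: null_sets_def borel_compact)
  moreover have "emeasure lborel L < \<infinity>" by (rule emeasure_compact_finite[OF L(1)])
  ultimately show ?thesis by (simp add: measure_def enn2real_positive_iff zero_less_iff_neq_zero)
qed

lemma emeasure_convex_body:
  assumes "convex_body (L :: 'a::euclidean_space set)"
  shows "emeasure lborel L = ennreal (measure lborel L)"
  using emeasure_compact_finite[of L] assms
  by (intro emeasure_eq_ennreal_measure) (auto simp: less_top convex_body_def)

lemma convex_body_set_integrable:
  fixes L :: "'a::euclidean_space set" and f :: "'a \<Rightarrow> real"
  assumes "convex_body L" "continuous_on L f"
  shows "set_integrable lborel L f"
  using assms unfolding set_integrable_def convex_body_def by (intro borel_integrable_compact) auto

lemma set_integral_const_body: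
  fixes c :: real
  assumes "convex_body (L :: 'a::euclidean_space set)"
  shows "(LINT y:L|lborel. c) = c * measure lborel L"
  using assms by (simp add: set_lebesgue_integral_def convex_body_def borel_compact)

text \<open>
  If the integral were 0, the body would lie in the hyperplane orthogonal to \<open>x\<close>, up to
  a null set.
\<close>
lemma second_moment_pos:
  fixes L :: "'a::euclidean_space set"
  assumes L: "convex_body L" and x: "x \<noteq> 0"
  shows "0 < (LINT y:L|lborel. (x \<bullet> y)\<^sup>2)"
proof -
  have [measurable]: "L \<in> sets borel" using L by (simp add: convex_body_def borel_compact)
  have i: "integrable lborel (\<lambda>y. indicator L y * (x \<bullet> y)\<^sup>2)"
    using convex_body_set_integrable[OF L, of "\<lambda>y. (x \<bullet> y)\<^sup>2"] by (simp add: set_integrable_def continuous_intros)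
  have "(LINT y:L|lborel. (x \<bullet> y)\<^sup>2) \<noteq> 0"
  proof
    assume "(LINT y:L|lborel. (x \<bullet> y)\<^sup>2) = 0"
    then have "(\<integral>y. indicator L y * (x \<bullet> y)\<^sup>2 \<partial>lborel) = 0" by (simp add: set_lebesgue_integral_def)
    then have 1: "AE y in lborel. indicator L y * (x \<bullet> y)\<^sup>2 = 0"
      by (subst (asm) integral_nonneg_eq_0_iff_AE[OF i]) auto
    have "AE y in lborel. x \<bullet> y \<noteq> 0" by (rule AE_inner_neq) (simp add: x)
    with 1 have "AE y in lborel. y \<notin> L" by eventually_elim (auto simp: indicator_def split: if_splits)
    then have "emeasure lborel L = 0" by (simp add: AE_iff_measurable[OF _ refl] flip: AE_iff_null_sets)
    then show False using measure_convex_body_pos[OF L] by (simp add: measure_def)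
  qed
  moreover have "0 \<le> (LINT y:L|lborel. (x \<bullet> y)\<^sup>2)"
    unfolding set_lebesgue_integral_def by (intro integral_nonneg_AE) (auto simp: indicator_def)
  ultimately show ?thesis by simp
qed

text \<open>
  The parameter \<open>r\<close> is the apex height of the cone on which the functional has the same
  mean and mean square as on \<open>L\<close>.
\<close>
locale centered_body =
  fixes L :: "'a::euclidean_space set" and x :: 'a and r :: real
  assumes body: "convex_body L" and x: "x \<noteq> 0" and r: "0 < r"
    and mean: "(LINT y:L|lborel. x \<bullet> y) = 0"
    and var: "(LINT y:L|lborel. (x \<bullet> y)\<^sup>2) = measure lborel L * (r\<^sup>2 / (real DIM('a) * (real DIM('a) + 2)))"
begin

lemma L: "compact L" "convex L" "0 < measure lborel L"
  using body measure_convex_body_pos by (auto simp: convex_body_def)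

text \<open>
  The integral on the right, plus \<open>h p\<close>, is the mean of \<open>h\<close> of the
  functional over the comparison cone. The difference of the two tails is orthogonal to affine
  functions by the choice of \<open>r\<close>, and it is positive on an interval only: the
  \<open>n\<close>-th root of the tail of \<open>L\<close> is concave where it is positive, whereas
  above the base that of the cone is the convex function \<open>max 0 (cone_slope n r a)\<close>.
\<close>
theorem cone_comparison:
  assumes range: "\<And>y. y \<in> L \<Longrightarrow> x \<bullet> y \<in> {p..B}" and p: "p \<le> - r / DIM('a)" and B: "r \<le> B"
    and h: "\<And>a. a \<in> {p..B} \<Longrightarrow> (h has_real_derivative k a) (at a)"
    and k: "continuous_on {p..B} k" "convex_on {p..B} k" "\<And>a. a \<in> {p..B} \<Longrightarrow> 0 \<le> k a"
  shows "(LINT y:L|lborel. h (x \<bullet> y))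
       \<le> measure lborel L * (h p + integral {p..B} (\<lambda>a. k a * cone_tail DIM('a) r a))"
proof -
  let ?n = "DIM('a)" and ?m = "measure lborel L" and ?c = "cone_tail DIM('a) r"
  have n: "0 < ?n" by simp
  note mom = cone_tail_moments[OF r n p B]
  define D where "D a = tail L x a / ?m - ?c a" for a
  have tc: "continuous_on S (tail L x)" for S by (rule continuous_tail[OF L(1) x])
  have Dc: "continuous_on {p..B} D"
    unfolding D_def using L(3) by (intro continuous_intros tc continuous_cone_tail) auto
  have int: "(\<lambda>a. f a * tail L x a / ?m) integrable_on {p..B}" "(\<lambda>a. f a * ?c a) integrable_on {p..B}"
    if "continuous_on {p..B} f" for f
    using L(3) by (auto intro!: integrable_continuous_interval continuous_intros tc continuous_cone_tail that)
  have split: "integral {p..B} (\<lambda>a. f a * D a) = integral {p..B} (\<lambda>a. f a * tail L x a) / ?m - integral {p..B} (\<lambda>a. f a * ?c a)"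
    if "continuous_on {p..B} f" for f
    unfolding D_def right_diff_distrib times_divide_eq_right
    by (subst integral_diff[OF int[OF that]]) simp
  have t0: "integral {p..B} (tail L x) = - p * ?m"
    using integral_tail[OF L(1) x range, where h = "\<lambda>a. a" and k = "\<lambda>_. 1"] mean
    by (simp add: DERIV_ident)
  have zero: "integral {p..B} D = 0"
    using split[of "\<lambda>_. 1"] t0 L(3) integral_unique[OF mom(1)] by simp
  (* The layer-cake formula needs a nonnegative derivative, so the square is centred at p. *)
  have "(LINT y:L|lborel. (x \<bullet> y - p)\<^sup>2) = integral {p..B} (\<lambda>a. 2 * (a - p) * tail L x a)"
  proof -
    have "(LINT y:L|lborel. (x \<bullet> y - p)\<^sup>2) = (p - p)\<^sup>2 * ?m + integral {p..B} (\<lambda>a. 2 * (a - p) * tail L x a)"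
      by (rule integral_tail[OF L(1) x range])
         (auto intro!: derivative_eq_intros continuous_intros)
    then show ?thesis by simp
  qed
  moreover have "(LINT y:L|lborel. (x \<bullet> y - p)\<^sup>2) = ?m * (r\<^sup>2 / (real ?n * (real ?n + 2))) + p\<^sup>2 * ?m"
  proof -
    have i: "set_integrable lborel L f" if "continuous_on L f" for f :: "'a \<Rightarrow> real"
      unfolding set_integrable_def by (rule borel_integrable_compact[OF L(1) that])
    have "(LINT y:L|lborel. (x \<bullet> y - p)\<^sup>2) = (LINT y:L|lborel. ((x \<bullet> y)\<^sup>2 - (2 * p) * (x \<bullet> y)) + p\<^sup>2)"
      by (simp add: power2_diff algebra_simps)
    also have "\<dots> = (LINT y:L|lborel. (x \<bullet> y)\<^sup>2) - (2 * p) * (LINT y:L|lborel. x \<bullet> y) + (LINT y:L|lborel. p\<^sup>2)"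
      by (subst set_integral_add set_integral_diff set_integral_mult_right, (intro i continuous_intros)+)+ simp
    also have "(LINT y:L|lborel. p\<^sup>2) = p\<^sup>2 * ?m"
      using L(1) by (simp add: set_lebesgue_integral_def borel_compact)
    finally show ?thesis using mean var by simp
  qed
  moreover have "integral {p..B} (\<lambda>a. 2 * (a - p) * tail L x a)
      = 2 * integral {p..B} (\<lambda>a. a * tail L x a) - 2 * p * integral {p..B} (tail L x)"
  proof -
    have "(\<lambda>a. 2 * (a - p) * tail L x a) = (\<lambda>a. 2 * (a * tail L x a) - 2 * p * tail L x a)"
      by (simp add: algebra_simps)
    then show ?thesis
      by (simp, subst integral_diff) (auto intro!: integrable_continuous_interval continuous_intros tc)
  qed
  ultimately have t1: "integral {p..B} (\<lambda>a. a * tail L x a) = ?m * ((r\<^sup>2 / (real ?n * (real ?n + 2)) - p\<^sup>2) / 2)"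
    using t0 by (simp add: algebra_simps power2_eq_square)
  have one: "integral {p..B} (\<lambda>a. a * D a) = 0"
    using split[of "\<lambda>a. a"] t1 L(3) integral_unique[OF mom(2)] by (simp add: continuous_on_id)
  have main: "integral {p..B} (\<lambda>a. k a * D a) \<le> 0"
  proof (rule integral_mult_convex_nonpos[OF Dc k _ zero one])
    fix u w v assume uwv: "u < w" "w < v" and Du: "0 < D u" and Dv: "0 < D v"
    define \<rho> where "\<rho> = root ?n ?m"
    have \<rho>: "0 < \<rho>" "\<rho> ^ ?n = ?m" using L(3) by (auto simp: \<rho>_def)
    have D_iff: "0 < D a \<longleftrightarrow> ?m * ?c a < tail L x a" for a
      using L(3) by (simp add: D_def field_simps)
    have "\<not> u \<le> - r / ?n"
    proof
      assume "u \<le> - r / ?n"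
      then have "?c u = 1" using r by (simp add: cone_tail_below)
      moreover have "tail L x u \<le> ?m"
        unfolding tail_def using L(1)
        by (intro measure_mono_fmeasurable) (auto intro: fmeasurable_compact borel_compact)
      ultimately show False using Du by (simp add: D_iff)
    qed
    then have b: "- r / ?n \<le> u" "- r / ?n \<le> v" using uwv by auto
    let ?s = "\<lambda>a. max 0 (cone_slope ?n r a)"
    have key: "\<rho> * ?s a < root ?n (tail L x a)" if "- r / ?n \<le> a" "0 < D a" for a
    proof -
      have "(\<rho> * ?s a) ^ ?n < tail L x a"
        using that r \<rho> by (simp add: D_iff cone_tail_right_of_base power_mult_distrib)
      then have "root ?n ((\<rho> * ?s a) ^ ?n) < root ?n (tail L x a)" by simp
      moreover have "root ?n ((\<rho> * ?s a) ^ ?n) = \<rho> * ?s a"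
        using \<rho> by (intro real_root_power_cancel) auto
      ultimately show ?thesis by simp
    qed
    have tpos: "0 < tail L x u" "0 < tail L x v"
      using Du Dv cone_tail_nonneg[of ?n r] L(3) unfolding D_iff
      by (meson le_less_trans mult_nonneg_nonneg less_imp_le)+
    define \<theta> where "\<theta> = (w - u) / (v - u)"
    have \<theta>: "0 < \<theta>" "\<theta> < 1" using uwv by (auto simp: \<theta>_def)
    have "\<theta> * (v - u) = w - u" using uwv by (simp add: \<theta>_def)
    then have w: "w = (1 - \<theta>) * u + \<theta> * v" by (simp add: algebra_simps)
    have slope: "cone_slope ?n r w = (1 - \<theta>) * cone_slope ?n r u + \<theta> * cone_slope ?n r v"
      unfolding w cone_slope_def times_divide_eq_right add_divide_distrib[symmetric]
      by (rule arg_cong[where f = "\<lambda>z. z / _"]) (simp add: algebra_simps)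
    have "?s w \<le> (1 - \<theta>) * ?s u + \<theta> * ?s v"
      unfolding slope using \<theta>
      by (intro max.boundedI add_mono mult_left_mono add_nonneg_nonneg mult_nonneg_nonneg) auto
    then have "\<rho> * ?s w \<le> \<rho> * ((1 - \<theta>) * ?s u + \<theta> * ?s v)"
      using \<rho> by (intro mult_left_mono) auto
    also have "\<dots> = (1 - \<theta>) * (\<rho> * ?s u) + \<theta> * (\<rho> * ?s v)" by (simp add: algebra_simps)
    also have "\<dots> < (1 - \<theta>) * root ?n (tail L x u) + \<theta> * root ?n (tail L x v)"
      using \<theta> key[OF b(1) Du] key[OF b(2) Dv] by (intro add_strict_mono mult_strict_left_mono) auto
    also have "\<dots> \<le> root ?n (tail L x w)"
      unfolding w using \<theta> by (intro root_tail_concave L x tpos) auto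
    finally have lt: "\<rho> * ?s w < root ?n (tail L x w)" .
    have "?m * ?c w \<le> (\<rho> * ?s w) ^ ?n"
      using cone_tail_le[of ?n r w] L(3) by (simp add: power_mult_distrib \<rho>)
    also have "\<dots> < root ?n (tail L x w) ^ ?n"
      using lt \<rho> by (intro power_strict_mono) auto
    also have "\<dots> = tail L x w" by (simp add: tail_nonneg)
    finally show "0 < D w" by (simp add: D_iff)
  qed
  have "(LINT y:L|lborel. h (x \<bullet> y)) = h p * ?m + integral {p..B} (\<lambda>a. k a * tail L x a)"
    by (rule integral_tail[OF L(1) x range h k(1,3)])
  also have "\<dots> \<le> h p * ?m + ?m * integral {p..B} (\<lambda>a. k a * ?c a)"
  proof -
    have "integral {p..B} (\<lambda>a. k a * tail L x a) / ?m \<le> integral {p..B} (\<lambda>a. k a * ?c a)"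
      using main split[OF k(1)] by simp
    then show ?thesis using L(3) by (simp add: pos_divide_le_eq mult.commute)
  qed
  finally show ?thesis by (simp add: algebra_simps)
qed
end

lemma DERIV_max_square:
  fixes a c :: real
  shows "((\<lambda>a. (max 0 (a - c))\<^sup>2) has_real_derivative 2 * max 0 (a - c)) (at a)"
proof (cases "a = c")
  case True
  have "((\<lambda>t. ((max 0 (c + t - c))\<^sup>2 - (max 0 (c - c))\<^sup>2) / t) \<longlongrightarrow> 0) (at 0)"
  proof (rule Lim_null_comparison)
    show "\<forall>\<^sub>F t in at 0. norm (((max 0 (c + t - c))\<^sup>2 - (max 0 (c - c))\<^sup>2) / t) \<le> \<bar>t\<bar>"
      by (intro always_eventually allI) (auto simp: max_def power2_eq_square)
    show "((\<lambda>t::real. \<bar>t\<bar>) \<longlongrightarrow> 0) (at 0)"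
      by (auto intro!: tendsto_eq_intros)
  qed
  then show ?thesis using True by (simp add: DERIV_def)
next
  case False
  then consider "a < c" | "c < a" by linarith
  then show ?thesis
  proof cases
    case 1
    have "((\<lambda>a. 0::real) has_real_derivative 2 * max 0 (a - c)) (at a)"
      using 1 by (auto simp: max_def)
    then show ?thesis
      by (rule has_field_derivative_transform_within_open[where S = "{..<c}"]) (use 1 in auto)
  next
    case 2
    have "((\<lambda>a. (a - c)\<^sup>2) has_real_derivative 2 * max 0 (a - c)) (at a)"
      using 2 by (auto intro!: derivative_eq_intros)
    then show ?thesis
      by (rule has_field_derivative_transform_within_open[where S = "{c<..}"]) (use 2 in auto)
  qed
qed

lemma convex_on_max_diff: "convex_on {p..B} (\<lambda>a::real. 2 * max 0 (a - c))"
proof (rule convex_on_cmul)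
  show "convex_on {p..B} (\<lambda>a. max 0 (a - c))"
  proof (rule convex_onI)
    fix t a b :: real assume t: "0 < t" "t < 1"
    have "(1 - t) *\<^sub>R a + t *\<^sub>R b - c = (1 - t) * (a - c) + t * (b - c)" by (simp add: algebra_simps)
    also have "\<dots> \<le> (1 - t) * max 0 (a - c) + t * max 0 (b - c)"
      using t by (intro add_mono mult_left_mono) auto
    finally show "max 0 ((1 - t) *\<^sub>R a + t *\<^sub>R b - c) \<le> (1 - t) * max 0 (a - c) + t * max 0 (b - c)"
      using t by simp
  qed simp
qed simp

text \<open>
  The left-hand side is the mean over the comparison cone of \<open>1 / (1 - a) ^ (n + 1)\<close>,
  where \<open>a\<close> is the level.
\<close>
lemma cone_integral_value_le:
  fixes r :: real assumes r: "0 < r" "r < 1" and n: "0 < n"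
  shows "1 / ((1 - r) * (1 + r / real n) ^ n) \<le> 1 / (1 - r\<^sup>2)"
proof -
  have "1 + real n * (r / real n) \<le> (1 + r / real n) ^ n"
    using r by (intro Bernoulli_inequality) (auto intro: order_trans[of _ 0])
  then have "1 + r \<le> (1 + r / real n) ^ n" using n by simp
  then have "(1 - r) * (1 + r) \<le> (1 - r) * (1 + r / real n) ^ n"
    using r by (intro mult_left_mono) auto
  moreover have "(1 - r) * (1 + r) = 1 - r\<^sup>2" by (simp add: power2_eq_square algebra_simps)
  moreover have "0 < 1 - r\<^sup>2" using r by (simp add: power_less_one_iff abs_square_less_1)
  ultimately show ?thesis by (intro divide_left_mono) auto
qed

context centered_body
begin

lemma functional_range:
  obtains p B where "\<And>y. y \<in> L \<Longrightarrow> x \<bullet> y \<in> {p..B}" "p \<le> - r / DIM('a)" "r \<le> B"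
proof -
  have "compact ((\<bullet>) x ` L)"
    by (intro compact_continuous_image L continuous_intros)
  then have "bounded ((\<bullet>) x ` L)" by (rule compact_imp_bounded)
  then obtain b where b: "\<And>y. y \<in> L \<Longrightarrow> \<bar>x \<bullet> y\<bar> \<le> b" by (auto simp: bounded_iff)
  show ?thesis
  proof (rule that)
    show "x \<bullet> y \<in> {min (- b) (- r / DIM('a))..max b r}" if "y \<in> L" for y
      using b[OF that] by (simp add: abs_le_iff min_le_iff_disj le_max_iff_disj)
  qed (rule min.cobounded2 max.cobounded2)+
qed

text \<open>
  Compare with the cone for \<open>h a = (max 0 (a - r))\<^sup>2\<close>, which vanishes on the
  cone. Hence \<open>x \<bullet> y \<le> r\<close> for almost all \<open>y \<in> L\<close>, and then
  for all of them, because \<open>L\<close> is the closure of its interior.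
\<close>
lemma functional_le:
  assumes y: "y \<in> L" shows "x \<bullet> y \<le> r"
proof (rule ccontr)
  assume yr: "\<not> x \<bullet> y \<le> r"
  obtain p B where range: "\<And>y. y \<in> L \<Longrightarrow> x \<bullet> y \<in> {p..B}" and p: "p \<le> - r / DIM('a)" and B: "r \<le> B"
    using functional_range by blast
  have "0 \<le> r / DIM('a)" using r by simp
  then have pr: "p \<le> r" using p r by linarith
  have "(LINT y:L|lborel. (max 0 (x \<bullet> y - r))\<^sup>2)
     \<le> measure lborel L * ((max 0 (p - r))\<^sup>2 + integral {p..B} (\<lambda>a. 2 * max 0 (a - r) * cone_tail DIM('a) r a))"
    by (rule cone_comparison[OF range p B DERIV_max_square _ convex_on_max_diff])
       (auto intro!: continuous_intros)
  also have "(\<lambda>a. 2 * max 0 (a - r) * cone_tail DIM('a) r a) = (\<lambda>a. 0)"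
    using r by (auto simp: fun_eq_iff max_def cone_tail_above)
  finally have le: "(LINT y:L|lborel. (max 0 (x \<bullet> y - r))\<^sup>2) \<le> 0" using pr by simp
  have i: "set_integrable lborel L (\<lambda>y. (max 0 (x \<bullet> y - r))\<^sup>2)"
    by (intro convex_body_set_integrable[OF body] continuous_intros)
  have "(\<integral>y. indicator L y * (max 0 (x \<bullet> y - r))\<^sup>2 \<partial>lborel) = 0"
    using le by (intro antisym integral_nonneg_AE) (auto simp: set_lebesgue_integral_def)
  then have "AE y in lborel. indicator L y * (max 0 (x \<bullet> y - r))\<^sup>2 = 0"
    using i by (subst (asm) integral_nonneg_eq_0_iff_AE) (auto simp: set_integrable_def)
  then have "AE y in lebesgue. indicator L y * (max 0 (x \<bullet> y - r))\<^sup>2 = 0"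
    by (rule AE_completion)
  then have ae: "AE y in lebesgue. y \<notin> interior L \<inter> {y. r < x \<bullet> y}"
    by eventually_elim (use interior_subset in \<open>force simp: indicator_def max_def split: if_splits\<close>)
  define U where "U = interior L \<inter> {y. r < x \<bullet> y}"
  have U: "open U" unfolding U_def by (intro open_Int open_interior open_halfspace_gt)
  have "U \<in> null_sets lebesgue"
    using ae U by (subst AE_iff_null_sets) (auto simp: U_def)
  then have "U = {}" using U open_not_negligible negligible_iff_null_sets by blast
  then have "{y. r < x \<bullet> y} \<inter> closure (interior L) = {}"
    using open_Int_closure_eq_empty[OF open_halfspace_gt[of r x], of "interior L"]
    by (simp add: U_def Int_commute)
  moreover have "y \<in> closure (interior L)"
    using body y closure_subset[of L] convex_closure_interior[of L] by (auto simp: convex_body_def)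
  then have "y \<in> {y. r < x \<bullet> y} \<inter> closure (interior L)" using yr by simp
  ultimately show False by blast
qed

lemma reflection: "centered_body L (- x) r"
proof -
  have "(LINT y:L|lborel. - x \<bullet> y) = - (LINT y:L|lborel. x \<bullet> y)"
    by (simp add: set_lebesgue_integral_def)
  then show ?thesis using body x r mean var by unfold_locales simp_all
qed

text \<open>
  Comparison with the cone, for which the integral is elementary: up to a constant, the power of
  \<open>cone_slope n r a / (1 - a)\<close> with exponent \<open>n + 1\<close> is an antiderivative.
\<close>
lemma integral_inverse_power_le:
  assumes r1: "r < 1"
  shows "(LINT y:L|lborel. 1 / (1 - x \<bullet> y) ^ Suc DIM('a)) \<le> measure lborel L / (1 - r\<^sup>2)"
proof -
  let ?n = "DIM('a)"
  have n: "0 < ?n" by simp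
  obtain p B where pB: "\<And>y. y \<in> L \<Longrightarrow> x \<bullet> y \<in> {p..B}" and p: "p \<le> - r / DIM('a)"
    using functional_range by blast
  have range: "\<And>y. y \<in> L \<Longrightarrow> x \<bullet> y \<in> {p..r}" using pB functional_le by auto
  define h where "h a = 1 / (1 - a) ^ Suc ?n" for a :: real
  define k where "k a = real (Suc ?n) / (1 - a) ^ Suc (Suc ?n)" for a :: real
  have dpow: "((\<lambda>a. c / (1 - a) ^ m) has_real_derivative c * real m / (1 - a) ^ Suc m) (at a)" if "a < 1" for a c m
  proof -
    have 1: "((\<lambda>a. c * inverse ((1 - a) ^ m)) has_real_derivative c * (- (inverse ((1 - a) ^ m) * (real m * (1 - a) ^ (m - 1) * (0 - 1)) * inverse ((1 - a) ^ m)))) (at a)"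
      using that by (auto intro!: derivative_eq_intros)
    have "c * (- (inverse (d ^ m) * (real m * d ^ (m - 1) * (0 - 1)) * inverse (d ^ m))) = c * real m / d ^ Suc m"
      if "d \<noteq> 0" for d :: real
      using that by (cases m) (auto simp: field_simps)
    from this[of "1 - a"] have 2: "c * (- (inverse ((1 - a) ^ m) * (real m * (1 - a) ^ (m - 1) * (0 - 1)) * inverse ((1 - a) ^ m))) = c * real m / (1 - a) ^ Suc m"
      using that by simp
    have eq: "(\<lambda>a. c / (1 - a) ^ m) = (\<lambda>a. c * inverse ((1 - a) ^ m))" by (simp add: divide_inverse)
    show ?thesis unfolding eq using 1 unfolding 2 .
  qed
  have dh: "(h has_real_derivative k a) (at a)" if "a \<in> {p..r}" for a
    using dpow[of a 1 "Suc ?n"] that r1 unfolding h_def[abs_def] k_def by simp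
  have kc: "continuous_on {p..r} k"
    unfolding k_def[abs_def] using r1 by (intro continuous_intros) auto
  have kconv: "convex_on {p..r} k"
  proof (rule convex_on_realI)
    show "(k has_real_derivative real (Suc ?n) * real (Suc (Suc ?n)) / (1 - a) ^ Suc (Suc (Suc ?n))) (at a)"
      if "a \<in> {p..r}" for a
      using dpow[of a "real (Suc ?n)" "Suc (Suc ?n)"] that r1 unfolding k_def[abs_def] by simp
    show "real (Suc ?n) * real (Suc (Suc ?n)) / (1 - a) ^ Suc (Suc (Suc ?n)) \<le> real (Suc ?n) * real (Suc (Suc ?n)) / (1 - b) ^ Suc (Suc (Suc ?n))"
      if "a \<in> {p..r}" "b \<in> {p..r}" "a \<le> b" for a b
      using that r1 by (intro divide_left_mono power_mono mult_pos_pos zero_less_power) auto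
  qed simp
  have k0: "0 \<le> k a" if "a \<in> {p..r}" for a using that r1 by (simp add: k_def)
  define R where "R = cone_height ?n r"
  have R: "0 < R" unfolding R_def by (rule cone_height_pos[OF r n])
  have R1: "1 - r + R = 1 + r / real ?n" unfolding R_def using n by (simp add: cone_height_split)
  define q where "q a = cone_slope ?n r a / (1 - a)" for a
  define F where "F a = - (R / (1 - r)) * q a ^ Suc ?n" for a
  have dF: "(F has_real_derivative k a * cone_slope ?n r a ^ ?n) (at a)" if "a \<in> {- r / real ?n..r}" for a
  proof -
    have a1: "a < 1" using that r1 by simp
    have "(q has_real_derivative ((- (1 / R)) * (1 - a) - cone_slope ?n r a * (- 1)) / ((1 - a) * (1 - a))) (at a)"
    proof -
      have "(cone_slope ?n r has_real_derivative - (1 / R)) (at a)"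
        unfolding cone_slope_def[abs_def] R_def[symmetric] using R by (auto intro!: derivative_eq_intros)
      moreover have "((\<lambda>a. 1 - a) has_real_derivative - 1) (at a)"
        by (auto intro!: derivative_eq_intros)
      ultimately show ?thesis unfolding q_def[abs_def] using a1 by (intro DERIV_divide) auto
    qed
    moreover have "((- (1 / R)) * (1 - a) - cone_slope ?n r a * (- 1)) = - ((1 - r) / R)"
      using R by (simp add: cone_slope_def R_def[symmetric] field_simps)
    ultimately have "(q has_real_derivative - ((1 - r) / R) / ((1 - a) * (1 - a))) (at a)" by simp
    from DERIV_cmult[OF DERIV_power[OF this, of "Suc ?n"], of "- (R / (1 - r))"]
    have "(F has_real_derivative - (R / (1 - r)) * (real (Suc ?n) * (- ((1 - r) / R) / ((1 - a) * (1 - a)) * q a ^ ?n))) (at a)"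
      unfolding F_def[abs_def] by simp
    moreover have "- (R / (1 - r)) * (real (Suc ?n) * (- ((1 - r) / R) / ((1 - a) * (1 - a)) * q a ^ ?n)) = k a * cone_slope ?n r a ^ ?n"
      using R r1 a1 by (simp add: k_def q_def power_divide del: of_nat_Suc)
    ultimately show ?thesis by (simp only:)
  qed
  have "((\<lambda>a. k a * cone_tail ?n r a) has_integral (h (- r / real ?n) - h p + (F r - F (- r / real ?n)))) {p..r}"
  proof (rule cone_tail_integral[OF r n p order_refl _ dF])
    fix a assume a: "a \<in> {p..- r / real ?n}"
    have "0 \<le> r / real ?n" using r by simp
    then have "a \<le> r" using a r unfolding atLeastAtMost_iff by linarith
    then show "(h has_real_derivative k a) (at a)" using dh a by simp
  qed
  then have "h p + integral {p..r} (\<lambda>a. k a * cone_tail ?n r a) = h (- r / real ?n) - F (- r / real ?n)"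
    by (simp add: integral_unique F_def q_def)
  also have "\<dots> = (1 + R / (1 - r)) / (1 + r / real ?n) ^ Suc ?n"
    using r n by (simp add: h_def F_def q_def cone_slope_base power_divide add_divide_distrib)
  also have "1 + R / (1 - r) = (1 + r / real ?n) / (1 - r)"
    using r1 R1 by (simp add: field_simps)
  also have "(1 + r / real ?n) / (1 - r) / (1 + r / real ?n) ^ Suc ?n = 1 / ((1 - r) * (1 + r / real ?n) ^ ?n)"
  proof -
    have "1 + r / real ?n \<noteq> 0" using R1 R r1 by linarith
    then show ?thesis by simp
  qed
  also have "\<dots> \<le> 1 / (1 - r\<^sup>2)" by (rule cone_integral_value_le[OF r r1 n])
  finally have val: "h p + integral {p..r} (\<lambda>a. k a * cone_tail ?n r a) \<le> 1 / (1 - r\<^sup>2)" .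
  have "(LINT y:L|lborel. h (x \<bullet> y)) \<le> measure lborel L * (h p + integral {p..r} (\<lambda>a. k a * cone_tail ?n r a))"
    by (rule cone_comparison[OF range p order_refl dh kc kconv k0])
  also have "\<dots> \<le> measure lborel L * (1 / (1 - r\<^sup>2))"
    using val L(3) by (intro mult_left_mono) auto
  finally show ?thesis by (simp add: h_def)
qed

text \<open>
  For the cone the part above the barycentre carries the fraction \<open>2 (n / (n + 1)) ^ (n +
  1)\<close> of the second moment, and \<open>(1 - 1 / (n + 1)) ^ (n + 1) \<le> 1 / e\<close>.
\<close>
lemma upper_second_moment_le:
  "(LINT y:L|lborel. (max 0 (x \<bullet> y))\<^sup>2) \<le> 2 / exp 1 * (LINT y:L|lborel. (x \<bullet> y)\<^sup>2)"
proof -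
  let ?n = "DIM('a)"
  let ?N = "real ?n"
  have n: "0 < ?n" by simp
  obtain p B where range: "\<And>y. y \<in> L \<Longrightarrow> x \<bullet> y \<in> {p..B}" and p: "p \<le> - r / DIM('a)" and B: "r \<le> B"
    using functional_range by blast
  have "0 \<le> r / ?N" using r by simp
  then have p0: "p \<le> 0" using p by linarith
  let ?k = "\<lambda>a. 2 * max 0 (a - 0) * cone_tail ?n r a"
  define F where "F a = - (cone_height ?n r * r / (?N + 1)) * cone_slope ?n r a ^ Suc ?n
      + ((cone_height ?n r)\<^sup>2 / (?N + 2)) * cone_slope ?n r a ^ Suc (Suc ?n)" for a
  have "((\<lambda>a. a * cone_slope ?n r a ^ ?n) has_integral (F r - F 0)) {0..r}"
    by (rule fundamental_theorem_of_calculus)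
       (use r DERIV_cone_first_moment[OF r n] in \<open>auto simp: F_def[abs_def] has_real_derivative_iff_has_vector_derivative[symmetric]
          intro: has_field_derivative_at_within\<close>)
  then have "((\<lambda>a. 2 * (a * cone_slope ?n r a ^ ?n)) has_integral 2 * (F r - F 0)) {0..r}"
    by (rule has_integral_mult_right)
  then have i2: "(?k has_integral 2 * (F r - F 0)) {0..r}"
  proof (rule has_integral_eq[rotated])
    fix a assume a: "a \<in> {0..r}"
    then have "- r / ?N \<le> a" using \<open>0 \<le> r / ?N\<close> unfolding atLeastAtMost_iff by linarith
    then show "2 * (a * cone_slope ?n r a ^ ?n) = ?k a"
      using a r by (simp add: cone_tail_between)
  qed
  have i1: "(?k has_integral 0) {p..0}"
    by (rule has_integral_eq[of _ "\<lambda>a. 0"]) auto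
  have i3: "(?k has_integral 0) {r..B}"
    by (rule has_integral_eq[of _ "\<lambda>a. 0"]) (use r in \<open>auto simp: cone_tail_above\<close>)
  have "(?k has_integral (0 + 2 * (F r - F 0) + 0)) {p..B}"
    using has_integral_combine[OF _ B has_integral_combine[OF p0 _ i1 i2] i3] p0 r by simp
  then have int: "integral {p..B} ?k = 2 * (F r - F 0)" by (simp add: integral_unique)
  define T where "T = cone_slope ?n r 0"
  have RT: "cone_height ?n r * T = r" using cone_height_pos[OF r n] by (simp add: T_def cone_slope_def)
  have T: "T = ?N / (?N + 1)" using r by (simp add: T_def cone_slope_def cone_height_def)
  have "F r - F 0 = (cone_height ?n r * T) * r / (?N + 1) * T ^ ?n - (cone_height ?n r * T)\<^sup>2 / (?N + 2) * T ^ ?n"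
    by (simp add: F_def T_def[symmetric] power_mult_distrib power2_eq_square mult_ac)
  also have "\<dots> = r\<^sup>2 * T ^ ?n * (1 / (?N + 1) - 1 / (?N + 2))"
    unfolding RT by (simp add: power2_eq_square algebra_simps)
  also have "1 / (?N + 1) - 1 / (?N + 2) = 1 / ((?N + 1) * (?N + 2))"
    by (simp add: divide_simps)
  also have "r\<^sup>2 * T ^ ?n * (1 / ((?N + 1) * (?N + 2))) = T ^ Suc ?n * (r\<^sup>2 / (?N * (?N + 2)))"
  proof -
    have "c * t * (1 / ((N + 1) * (N + 2))) = N / (N + 1) * t * (c / (N * (N + 2)))" if "0 < N" for N t c :: real
      using that by (simp add: divide_simps)
    from this[of ?N "r\<^sup>2" "T ^ ?n"] show ?thesis using T by simp
  qed
  finally have val: "F r - F 0 = T ^ Suc ?n * (r\<^sup>2 / (?N * (?N + 2)))" .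
  have "T ^ Suc ?n \<le> 1 / exp 1"
  proof -
    have "T = 1 + - (1 / real (Suc ?n))" by (simp add: T field_simps)
    also have "\<dots> \<le> exp (- (1 / real (Suc ?n)))" by (rule exp_ge_add_one_self)
    finally have "T ^ Suc ?n \<le> exp (- (1 / real (Suc ?n))) ^ Suc ?n"
      by (intro power_mono) (auto simp: T)
    also have "\<dots> = exp (real (Suc ?n) * - (1 / real (Suc ?n)))" by (rule exp_of_nat_mult[symmetric])
    also have "\<dots> = 1 / exp 1" by (simp add: exp_minus inverse_eq_divide del: of_nat_Suc)
    finally show ?thesis .
  qed
  then have F_le: "2 * (F r - F 0) \<le> 2 * (1 / exp 1 * (r\<^sup>2 / (?N * (?N + 2))))"
    unfolding val by (intro mult_left_mono mult_right_mono) auto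
  have "(LINT y:L|lborel. (max 0 (x \<bullet> y - 0))\<^sup>2) \<le> measure lborel L * ((max 0 (p - 0))\<^sup>2 + integral {p..B} ?k)"
    by (rule cone_comparison[OF range p B DERIV_max_square _ convex_on_max_diff])
       (auto intro!: continuous_intros)
  also have "\<dots> = measure lborel L * (2 * (F r - F 0))" using p0 unfolding int by simp
  also have "\<dots> \<le> measure lborel L * (2 * (1 / exp 1 * (r\<^sup>2 / (?N * (?N + 2)))))"
    using F_le L(3) by (intro mult_left_mono) auto
  finally have "(LINT y:L|lborel. (max 0 (x \<bullet> y))\<^sup>2) \<le> measure lborel L * (2 * (1 / exp 1 * (r\<^sup>2 / (?N * (?N + 2)))))"
    by simp
  then show ?thesis unfolding var by (simp add: mult_ac)
qed

text \<open>
  Apply the preceding bound to the reflected functional \<open>- x\<close>: the part below the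
  barycentre carries at most the fraction \<open>2 / e\<close>.
\<close>
lemma second_moment_le_upper:
  "(1 - 2 / exp 1) * (LINT y:L|lborel. (x \<bullet> y)\<^sup>2) \<le> (LINT y:L|lborel. (max 0 (x \<bullet> y))\<^sup>2)"
proof -
  interpret neg: centered_body L "- x" r by (rule reflection)
  have "(LINT y:L|lborel. (x \<bullet> y)\<^sup>2) = (LINT y:L|lborel. (max 0 (x \<bullet> y))\<^sup>2 + (max 0 (- x \<bullet> y))\<^sup>2)"
    by (intro set_lebesgue_integral_cong) (use L(1) in \<open>auto simp: max_def borel_compact\<close>)
  also have "\<dots> = (LINT y:L|lborel. (max 0 (x \<bullet> y))\<^sup>2) + (LINT y:L|lborel. (max 0 (- x \<bullet> y))\<^sup>2)"
    by (intro set_integral_add convex_body_set_integrable[OF body] continuous_intros)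
  finally show ?thesis using neg.upper_second_moment_le by (simp add: algebra_simps)
qed

end

lemma centered_bodyI:
  fixes L :: "'a::euclidean_space set"
  assumes L: "convex_body L" and x: "x \<noteq> 0" and mean: "(LINT y:L|lborel. x \<bullet> y) = 0"
  shows "centered_body L x (sqrt (real DIM('a) * (real DIM('a) + 2) * ((LINT y:L|lborel. (x \<bullet> y)\<^sup>2) / measure lborel L)))"
proof -
  define W where "W = (LINT y:L|lborel. (x \<bullet> y)\<^sup>2) / measure lborel L"
  define c where "c = real DIM('a) * (real DIM('a) + 2)"
  have m: "0 < measure lborel L" by (rule measure_convex_body_pos[OF L])
  have W: "0 < W" using second_moment_pos[OF L x] m by (simp add: W_def)
  have c: "0 < c" unfolding c_def by (intro mult_pos_pos add_pos_pos) auto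
  have "(LINT y:L|lborel. (x \<bullet> y)\<^sup>2) = measure lborel L * ((sqrt (c * W))\<^sup>2 / c)"
  proof -
    have "(LINT y:L|lborel. (x \<bullet> y)\<^sup>2) = measure lborel L * W" using m by (simp add: W_def)
    moreover have "(sqrt (c * W))\<^sup>2 = c * W" using W c by simp
    ultimately show ?thesis using c by simp
  qed
  then have "centered_body L x (sqrt (c * W))"
    using assms W c by unfold_locales (auto simp: c_def)
  then show ?thesis by (simp only: c_def W_def)
qed

section \<open>Volumes of polar bodies\<close>

lemma closed_polar_at: "closed (polar_at K x)"
proof -
  have "polar_at K x = (\<Inter>z\<in>K. {y. (z - x) \<bullet> y \<le> 1})"
    by (auto simp: polar_at_def inner_commute)
  then show ?thesis by (auto intro!: closed_INT closed_halfspace_le)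
qed

lemma polar_borel [measurable]: "polar_at K x \<in> sets borel"
  using closed_polar_at by (rule borel_closed)

lemma polar_inner_le_1: "x \<in> K \<Longrightarrow> y \<in> polar_at K 0 \<Longrightarrow> x \<bullet> y \<le> 1"
  by (auto simp: polar_at_def inner_commute)

text \<open>
  A hyperplane that strictly separates \<open>x\<close> from \<open>K\<close> yields a point of the
  polar violating the hypothesis.
\<close>
lemma polar_at_bipolar:
  fixes K :: "'a::euclidean_space set"
  assumes K: "closed K" "convex K" "0 \<in> K" and x: "\<And>y. y \<in> polar_at K 0 \<Longrightarrow> x \<bullet> y \<le> 1"
  shows "x \<in> K"
proof (rule ccontr)
  assume "x \<notin> K"
  then obtain a b where ab: "a \<bullet> x < b" "\<And>z. z \<in> K \<Longrightarrow> b < a \<bullet> z"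
    using separating_hyperplane_closed_point[OF K(2,1)] by blast
  have b: "b < 0" using ab(2)[OF K(3)] by simp
  have "(1 / b) *\<^sub>R a \<in> polar_at K 0"
    using ab(2) b by (auto simp: polar_at_def field_simps less_imp_le)
  from x[OF this] have "(x \<bullet> a) / b \<le> 1" by simp
  then have "b \<le> a \<bullet> x" using b by (simp add: neg_divide_le_eq inner_commute)
  then show False using ab(1) by simp
qed

lemma convex_body_polar:
  fixes K :: "'a::euclidean_space set"
  assumes K: "convex_body K" and z: "0 \<in> interior K"
  shows "convex_body (polar_at K 0)"
  unfolding convex_body_def
proof (intro conjI)
  obtain e where e: "0 < e" "cball 0 e \<subseteq> K" using z by (auto simp: mem_interior_cball)
  have "polar_at K 0 \<subseteq> cball 0 (1 / e)"
  proof
    fix y assume y: "y \<in> polar_at K 0"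
    show "y \<in> cball 0 (1 / e)"
    proof (cases "y = 0")
      case False
      have "(e / norm y) *\<^sub>R y \<in> K" using e False by (intro subsetD[OF e(2)]) simp
      then have "y \<bullet> ((e / norm y) *\<^sub>R y) \<le> 1" using y by (auto simp: polar_at_def)
      then have "e * norm y \<le> 1" using False by (simp add: dot_square_norm power2_eq_square)
      then show ?thesis using e by (simp add: field_simps)
    qed (use e in simp)
  qed
  then show "compact (polar_at K 0)"
    using closed_polar_at bounded_subset compact_eq_bounded_closed bounded_cball by blast
  show "convex (polar_at K 0)"
  proof -
    have "polar_at K 0 = (\<Inter>z\<in>K. {y. z \<bullet> y \<le> 1})" by (auto simp: polar_at_def inner_commute)
    then show ?thesis by (auto intro!: convex_INT convex_halfspace_le)
  qed
  have "bounded K" using K by (auto simp: convex_body_def compact_imp_bounded)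
  then obtain b where b: "0 < b" "\<And>z. z \<in> K \<Longrightarrow> norm z \<le> b" using bounded_pos by blast
  have "ball 0 (1 / b) \<subseteq> polar_at K 0"
  proof
    fix y :: 'a assume y: "y \<in> ball 0 (1 / b)"
    have "y \<bullet> z \<le> 1" if "z \<in> K" for z
    proof -
      have "y \<bullet> z \<le> norm y * norm z" by (rule norm_cauchy_schwarz)
      also have "\<dots> \<le> (1 / b) * b" using y b that by (intro mult_mono) auto
      finally show ?thesis using b by simp
    qed
    then show "y \<in> polar_at K 0" by (simp add: polar_at_def)
  qed
  then have "ball 0 (1 / b) \<subseteq> interior (polar_at K 0)" by (rule interior_maximal) simp
  then show "interior (polar_at K 0) \<noteq> {}" using b by auto
qed

lemma nn_integral_scaleR:
  fixes f :: "'a::euclidean_space \<Rightarrow> ennreal"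
  assumes [measurable]: "f \<in> borel_measurable borel" and c: "0 < c"
  shows "(\<integral>\<^sup>+y. f y \<partial>lborel) = ennreal (c ^ DIM('a)) * (\<integral>\<^sup>+y. f (c *\<^sub>R y) \<partial>lborel)"
  using c by (subst lborel_affine[of c 0])
    (auto simp: nn_integral_density nn_integral_distr nn_integral_cmult)

lemma nn_integral_power_exp:
  assumes c: "0 < c"
  shows "(\<integral>\<^sup>+\<tau>. ennreal (\<tau> ^ n * exp (- (c * \<tau>))) * indicator {0..} \<tau> \<partial>lborel) = ennreal (fact n / c ^ Suc n)"
    (is "?I = _")
proof -
  have "ennreal (fact n) = (\<integral>\<^sup>+\<tau>. ennreal (\<tau> ^ n * exp (- \<tau>)) * indicator {0..} \<tau> \<partial>lborel)"
    by (simp add: nn_intergal_power_times_exp_Ici)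
  also have "\<dots> = ennreal c * (\<integral>\<^sup>+\<tau>. ennreal ((c * \<tau>) ^ n * exp (- (c * \<tau>))) * indicator {0..} (c * \<tau>) \<partial>lborel)"
    using c by (subst nn_integral_real_affine[of _ c 0]) auto
  also have "(\<integral>\<^sup>+\<tau>. ennreal ((c * \<tau>) ^ n * exp (- (c * \<tau>))) * indicator {0..} (c * \<tau>) \<partial>lborel)
      = (\<integral>\<^sup>+\<tau>. ennreal (c ^ n) * (ennreal (\<tau> ^ n * exp (- (c * \<tau>))) * indicator {0..} \<tau>) \<partial>lborel)"
    using c by (intro nn_integral_cong)
      (auto simp: indicator_def power_mult_distrib ennreal_mult[symmetric] mult.assoc zero_le_mult_iff)
  also have "\<dots> = ennreal (c ^ n) * ?I" by (rule nn_integral_cmult) measurable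
  finally have eq: "ennreal (fact n) = ennreal (c ^ Suc n) * ?I"
    using c by (simp add: ennreal_mult mult.assoc)
  have "ennreal (1 / c ^ Suc n) * ennreal (fact n) = (ennreal (1 / c ^ Suc n) * ennreal (c ^ Suc n)) * ?I"
    by (simp add: eq mult.assoc)
  also have "ennreal (1 / c ^ Suc n) * ennreal (c ^ Suc n) = 1"
    using c by (subst ennreal_mult[symmetric]) auto
  finally show ?thesis using c by (simp add: ennreal_mult[symmetric])
qed

lemma polar_cone_borel:
  fixes K :: "'a::euclidean_space set"
  shows "{p. \<forall>z\<in>K. snd p \<bullet> (z - x) \<le> fst p} \<in> sets (borel \<Otimes>\<^sub>M borel)"
proof -
  have "{p :: real \<times> 'a. \<forall>z\<in>K. snd p \<bullet> (z - x) \<le> fst p} = (\<Inter>z\<in>K. {p. snd p \<bullet> (z - x) \<le> fst p})"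
    by auto
  also have "closed \<dots>"
    by (auto intro!: closed_INT closed_Collect_le continuous_intros)
  finally show ?thesis unfolding borel_prod by (rule borel_closed)
qed

text \<open>
  Exchange the integrals and substitute \<open>\<tau> *\<^sub>R y\<close> for \<open>y\<close>,
  which turns the section of the cone at level \<open>\<tau>\<close> into the polar. The case
  \<open>u = 0\<close> computes a volume, the case of polars at 0 the integral it is equal to.
\<close>
lemma nn_integral_exp_polar:
  fixes K :: "'a::euclidean_space set"
  shows "(\<integral>\<^sup>+y. \<integral>\<^sup>+\<tau>. ennreal (exp (u \<bullet> y - \<tau>)) * indicator {0..} \<tau> * indicator {p. \<forall>z\<in>K. snd p \<bullet> (z - x) \<le> fst p} (\<tau>, y) \<partial>lborel \<partial>lborel)
    = (\<integral>\<^sup>+y. indicator (polar_at K x) y * (\<integral>\<^sup>+\<tau>. ennreal (\<tau> ^ DIM('a) * exp (- ((1 - u \<bullet> y) * \<tau>))) * indicator {0..} \<tau> \<partial>lborel) \<partial>lborel)"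
proof -
  let ?S = "{p :: real \<times> 'a. \<forall>z\<in>K. snd p \<bullet> (z - x) \<le> fst p}"
  let ?n = "DIM('a)"
  have [measurable]: "?S \<in> sets (borel \<Otimes>\<^sub>M borel)" by (rule polar_cone_borel)
  have "(\<integral>\<^sup>+y. \<integral>\<^sup>+\<tau>. ennreal (exp (u \<bullet> y - \<tau>)) * indicator {0..} \<tau> * indicator ?S (\<tau>, y) \<partial>lborel \<partial>lborel)
     = (\<integral>\<^sup>+\<tau>. \<integral>\<^sup>+y. ennreal (exp (u \<bullet> y - \<tau>)) * indicator {0..} \<tau> * indicator ?S (\<tau>, y) \<partial>lborel \<partial>lborel)"
    by (rule lborel_pair.Fubini') measurable
  also have "\<dots> = (\<integral>\<^sup>+\<tau>. \<integral>\<^sup>+y. ennreal (\<tau> ^ ?n * exp (- ((1 - u \<bullet> y) * \<tau>))) * indicator {0..} \<tau> * indicator (polar_at K x) y \<partial>lborel \<partial>lborel)"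
  proof (rule nn_integral_cong_AE, use AE_lborel_singleton[of 0] in eventually_elim)
    fix \<tau> :: real assume "\<tau> \<noteq> 0"
    show "(\<integral>\<^sup>+y. ennreal (exp (u \<bullet> y - \<tau>)) * indicator {0..} \<tau> * indicator ?S (\<tau>, y) \<partial>lborel)
        = (\<integral>\<^sup>+y. ennreal (\<tau> ^ ?n * exp (- ((1 - u \<bullet> y) * \<tau>))) * indicator {0..} \<tau> * indicator (polar_at K x) y \<partial>lborel)"
    proof (cases "0 < \<tau>")
      case True
      have "(\<integral>\<^sup>+y. ennreal (exp (u \<bullet> y - \<tau>)) * indicator {0..} \<tau> * indicator ?S (\<tau>, y) \<partial>lborel)
         = ennreal (\<tau> ^ ?n) * (\<integral>\<^sup>+y. ennreal (exp (u \<bullet> (\<tau> *\<^sub>R y) - \<tau>)) * indicator {0..} \<tau> * indicator ?S (\<tau>, \<tau> *\<^sub>R y) \<partial>lborel)"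
        by (rule nn_integral_scaleR[OF _ True]) measurable
      also have "\<dots> = (\<integral>\<^sup>+y. ennreal (\<tau> ^ ?n) * (ennreal (exp (u \<bullet> (\<tau> *\<^sub>R y) - \<tau>)) * indicator {0..} \<tau> * indicator ?S (\<tau>, \<tau> *\<^sub>R y)) \<partial>lborel)"
        by (rule nn_integral_cmult[symmetric]) measurable
      also have "\<dots> = (\<integral>\<^sup>+y. ennreal (\<tau> ^ ?n * exp (- ((1 - u \<bullet> y) * \<tau>))) * indicator {0..} \<tau> * indicator (polar_at K x) y \<partial>lborel)"
      proof (intro nn_integral_cong)
        fix y :: 'a
        have "(\<tau>, \<tau> *\<^sub>R y) \<in> ?S \<longleftrightarrow> y \<in> polar_at K x"
          using True by (auto simp: polar_at_def mult_le_cancel_left1)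
        then show "ennreal (\<tau> ^ ?n) * (ennreal (exp (u \<bullet> (\<tau> *\<^sub>R y) - \<tau>)) * indicator {0..} \<tau> * indicator ?S (\<tau>, \<tau> *\<^sub>R y))
          = ennreal (\<tau> ^ ?n * exp (- ((1 - u \<bullet> y) * \<tau>))) * indicator {0..} \<tau> * indicator (polar_at K x) y"
          using True by (simp add: ennreal_mult indicator_def algebra_simps)
      qed
      finally show ?thesis .
    qed (use \<open>\<tau> \<noteq> 0\<close> in simp)
  qed
  also have "\<dots> = (\<integral>\<^sup>+y. \<integral>\<^sup>+\<tau>. ennreal (\<tau> ^ ?n * exp (- ((1 - u \<bullet> y) * \<tau>))) * indicator {0..} \<tau> * indicator (polar_at K x) y \<partial>lborel \<partial>lborel)"
    by (rule lborel_pair.Fubini'[symmetric]) measurable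
  also have "\<dots> = (\<integral>\<^sup>+y. indicator (polar_at K x) y * (\<integral>\<^sup>+\<tau>. ennreal (\<tau> ^ ?n * exp (- ((1 - u \<bullet> y) * \<tau>))) * indicator {0..} \<tau> \<partial>lborel) \<partial>lborel)"
    by (intro nn_integral_cong, subst nn_integral_multc, measurable) (simp add: mult.commute)
  finally show ?thesis .
qed

text \<open>
  Where \<open>x \<bullet> y = 1\<close> the division by zero gives the value 0 instead of infinity.
  This happens on a null set only.
\<close>
definition polar_density :: "'a::euclidean_space set \<Rightarrow> 'a \<Rightarrow> 'a \<Rightarrow> real" where
  "polar_density K x y = indicator (polar_at K 0) y * (1 / (1 - x \<bullet> y) ^ Suc DIM('a))"

lemma polar_density_measurable [measurable]: "polar_density K x \<in> borel_measurable borel"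
  unfolding polar_density_def[abs_def] by measurable

text \<open>
  Both sides, multiplied by \<open>n!\<close>, are integrals over pairs \<open>(\<tau>, y)\<close>
  of exponentials, and the substitution \<open>\<tau> \<mapsto> \<tau> - x \<bullet> y\<close>
  carries one into the other. The argument also covers boundary points \<open>x\<close>, where both
  sides may be infinite.
\<close>
theorem emeasure_polar_at:
  fixes K :: "'a::euclidean_space set"
  assumes x: "x \<in> K" and z: "0 \<in> K"
  shows "emeasure lborel (polar_at K x)
    = (\<integral>\<^sup>+y. ennreal (polar_density K x y) \<partial>lborel)"
proof -
  let ?S = "\<lambda>x. {p :: real \<times> 'a. \<forall>z\<in>K. snd p \<bullet> (z - x) \<le> fst p}"
  let ?n = "DIM('a)"
  have [measurable]: "?S x \<in> sets (borel \<Otimes>\<^sub>M borel)" for x by (rule polar_cone_borel)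
  have "ennreal (fact ?n) * emeasure lborel (polar_at K x)
     = (\<integral>\<^sup>+y. indicator (polar_at K x) y * (\<integral>\<^sup>+\<tau>. ennreal (\<tau> ^ ?n * exp (- ((1 - 0 \<bullet> y) * \<tau>))) * indicator {0..} \<tau> \<partial>lborel) \<partial>lborel)"
  proof -
    have "(\<integral>\<^sup>+\<tau>. ennreal (\<tau> ^ ?n * exp (- ((1 - 0 \<bullet> y) * \<tau>))) * indicator {0..} \<tau> \<partial>lborel) = ennreal (fact ?n)" for y :: 'a
      using nn_integral_power_exp[of 1 ?n] by simp
    then show ?thesis
      using nn_integral_cmult_indicator[of "polar_at K x" lborel "ennreal (fact ?n)"] by (simp only: mult.commute) simp
  qed
  also have "\<dots> = (\<integral>\<^sup>+y. \<integral>\<^sup>+\<tau>. ennreal (exp (0 \<bullet> y - \<tau>)) * indicator {0..} \<tau> * indicator (?S x) (\<tau>, y) \<partial>lborel \<partial>lborel)"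
    by (rule nn_integral_exp_polar[symmetric])
  also have "\<dots> = (\<integral>\<^sup>+y. \<integral>\<^sup>+\<tau>. ennreal (exp (x \<bullet> y - \<tau>)) * indicator {0..} \<tau> * indicator (?S 0) (\<tau>, y) \<partial>lborel \<partial>lborel)"
  proof (rule nn_integral_cong)
    fix y :: 'a
    let ?f = "\<lambda>\<tau>. ennreal (exp (0 \<bullet> y - \<tau>)) * indicator {0..} \<tau> * indicator (?S x) (\<tau>, y)"
    have "(\<integral>\<^sup>+\<tau>. ?f \<tau> \<partial>lborel) = ennreal \<bar>1\<bar> * (\<integral>\<^sup>+\<tau>. ?f (- (x \<bullet> y) + 1 * \<tau>) \<partial>lborel)"
      by (rule nn_integral_real_affine) simp_all
    also have "\<dots> = (\<integral>\<^sup>+\<tau>. ?f (- (x \<bullet> y) + 1 * \<tau>) \<partial>lborel)" by simp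
    also have "\<dots> = (\<integral>\<^sup>+\<tau>. ennreal (exp (x \<bullet> y - \<tau>)) * indicator {0..} \<tau> * indicator (?S 0) (\<tau>, y) \<partial>lborel)"
    proof (rule nn_integral_cong)
      fix \<tau> :: real
      have "(- (x \<bullet> y) + 1 * \<tau>, y) \<in> ?S x \<longleftrightarrow> (\<tau>, y) \<in> ?S 0"
        by (auto simp: inner_diff_right inner_commute)
      moreover have "0 \<le> - (x \<bullet> y) + 1 * \<tau>" "0 \<le> \<tau>" if "(\<tau>, y) \<in> ?S 0"
        using that x z by (auto simp: inner_commute)
      ultimately show "?f (- (x \<bullet> y) + 1 * \<tau>)
         = ennreal (exp (x \<bullet> y - \<tau>)) * indicator {0..} \<tau> * indicator (?S 0) (\<tau>, y)"
        by (auto simp: indicator_def)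
    qed
    finally show "(\<integral>\<^sup>+\<tau>. ennreal (exp (0 \<bullet> y - \<tau>)) * indicator {0..} \<tau> * indicator (?S x) (\<tau>, y) \<partial>lborel)
       = (\<integral>\<^sup>+\<tau>. ennreal (exp (x \<bullet> y - \<tau>)) * indicator {0..} \<tau> * indicator (?S 0) (\<tau>, y) \<partial>lborel)" .
  qed
  also have "\<dots> = (\<integral>\<^sup>+y. indicator (polar_at K 0) y * (\<integral>\<^sup>+\<tau>. ennreal (\<tau> ^ ?n * exp (- ((1 - x \<bullet> y) * \<tau>))) * indicator {0..} \<tau> \<partial>lborel) \<partial>lborel)"
    by (rule nn_integral_exp_polar)
  also have "\<dots> = (\<integral>\<^sup>+y. ennreal (fact ?n) * ennreal (indicator (polar_at K 0) y * (1 / (1 - x \<bullet> y) ^ Suc ?n)) \<partial>lborel)"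
  proof (rule nn_integral_cong_AE)
    have "AE y in lborel. x \<bullet> y \<noteq> 1" by (rule AE_inner_neq) simp
    then show "AE y in lborel. indicator (polar_at K 0) y * (\<integral>\<^sup>+\<tau>. ennreal (\<tau> ^ ?n * exp (- ((1 - x \<bullet> y) * \<tau>))) * indicator {0..} \<tau> \<partial>lborel)
       = ennreal (fact ?n) * ennreal (indicator (polar_at K 0) y * (1 / (1 - x \<bullet> y) ^ Suc ?n))"
    proof eventually_elim
      case (elim y)
      show ?case
      proof (cases "y \<in> polar_at K 0")
        case True
        then have "x \<bullet> y \<le> 1" using x by (auto simp: polar_at_def inner_commute)
        then have "0 < 1 - x \<bullet> y" using elim by simp
        from nn_integral_power_exp[OF this, of ?n] show ?thesis
          using True \<open>0 < 1 - x \<bullet> y\<close> by (simp add: ennreal_mult[symmetric])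
      qed simp
    qed
  qed
  also have "\<dots> = ennreal (fact ?n) * (\<integral>\<^sup>+y. ennreal (indicator (polar_at K 0) y * (1 / (1 - x \<bullet> y) ^ Suc ?n)) \<partial>lborel)"
    by (rule nn_integral_cmult) measurable
  finally show ?thesis
    unfolding polar_density_def by (subst (asm) ennreal_mult_cancel_left) auto
qed

lemma polar_density_nonneg: "x \<in> K \<Longrightarrow> 0 \<le> polar_density K x y"
  using polar_inner_le_1[of x K y] by (auto simp: polar_density_def indicator_def intro!: divide_nonneg_nonneg mult_nonneg_nonneg)

lemma emeasure_polar_eq_integral:
  assumes "x \<in> K" "0 \<in> K" "integrable lborel (polar_density K x)"
  shows "emeasure lborel (polar_at K x) = ennreal (\<integral>y. polar_density K x y \<partial>lborel)"
  using emeasure_polar_at[OF assms(1,2)] assms(1,3)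
  by (simp add: nn_integral_eq_integral polar_density_nonneg)

lemma integrable_polar_density:
  assumes "x \<in> K" "0 \<in> K" "emeasure lborel (polar_at K x) < \<infinity>"
  shows "integrable lborel (polar_density K x)"
  using emeasure_polar_at[OF assms(1,2)] assms(1,3)
  by (intro integrableI_nonneg) (auto simp: polar_density_nonneg)

lemma integrable_polar_density_less_1:
  fixes K :: "'a::euclidean_space set"
  assumes L: "convex_body (polar_at K 0)" and s: "\<And>y. y \<in> polar_at K 0 \<Longrightarrow> x \<bullet> y < 1"
  shows "integrable lborel (polar_density K x)"
    and "(\<integral>y. polar_density K x y \<partial>lborel) = (LINT y:polar_at K 0|lborel. 1 / (1 - x \<bullet> y) ^ Suc DIM('a))"
proof -
  have "set_integrable lborel (polar_at K 0) (\<lambda>y::'a. 1 / (1 - x \<bullet> y) ^ Suc DIM('a))"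
    using s by (intro convex_body_set_integrable[OF L] continuous_intros) force
  then show "integrable lborel (polar_density K x)"
    by (simp add: set_integrable_def polar_density_def[abs_def])
  show "(\<integral>y. polar_density K x y \<partial>lborel) = (LINT y:polar_at K 0|lborel. 1 / (1 - x \<bullet> y) ^ Suc DIM('a))"
    by (simp add: set_lebesgue_integral_def polar_density_def)
qed

section \<open>The Santalo point and bounds for polar volumes\<close>

text \<open>
  For \<open>s \<ge> 0\<close> these are the first terms of a power series with nonnegative
  coefficients, here multiplied up from the geometric series. For \<open>s < 0\<close> it is
  Bernoulli's inequality.
\<close>
lemma inverse_power_ge:
  fixes s :: real
  assumes s: "s < 1"
  shows "1 + real m * s + real m * real (Suc m) / 2 * (max 0 s)\<^sup>2 \<le> 1 / (1 - s) ^ m"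
proof (cases "0 \<le> s")
  case True
  have step: "1 + s + s\<^sup>2 \<le> 1 / (1 - s)"
  proof -
    have "(1 + s + s\<^sup>2) * (1 - s) = 1 - s ^ 3" by (simp add: power2_eq_square power3_eq_cube algebra_simps)
    also have "\<dots> \<le> 1" using True by simp
    finally show ?thesis using s by (simp add: pos_le_divide_eq)
  qed
  have "1 + real m * s + real m * real (Suc m) / 2 * s\<^sup>2 \<le> 1 / (1 - s) ^ m"
  proof (induction m)
    case (Suc m)
    have "1 + real (Suc m) * s + real (Suc m) * real (Suc (Suc m)) / 2 * s\<^sup>2
       \<le> (1 + real m * s + real m * real (Suc m) / 2 * s\<^sup>2) * (1 + s + s\<^sup>2)"
    proof -
      have "(1 + real m * s + real m * real (Suc m) / 2 * s\<^sup>2) * (1 + s + s\<^sup>2)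
         - (1 + real (Suc m) * s + real (Suc m) * real (Suc (Suc m)) / 2 * s\<^sup>2)
         = (real m + real m * real (Suc m) / 2) * s ^ 3 + real m * real (Suc m) / 2 * s ^ 4"
        by (simp add: algebra_simps power2_eq_square power3_eq_cube power4_eq_xxxx add_divide_distrib)
      moreover have "0 \<le> (real m + real m * real (Suc m) / 2) * s ^ 3 + real m * real (Suc m) / 2 * s ^ 4"
        using True by (intro add_nonneg_nonneg mult_nonneg_nonneg) auto
      ultimately show ?thesis by linarith
    qed
    also have "\<dots> \<le> (1 / (1 - s) ^ m) * (1 / (1 - s))"
      using True s by (intro mult_mono Suc.IH step) (auto intro!: add_nonneg_nonneg)
    finally show ?case by (simp add: mult.commute)
  qed simp
  then show ?thesis using True by simp
next
  case False
  have "(1 + real m * s) * (1 - s) ^ m \<le> 1"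
  proof (cases "1 + real m * s \<le> 0")
    case True
    then have "(1 + real m * s) * (1 - s) ^ m \<le> 0"
      using s by (intro mult_nonpos_nonneg) auto
    then show ?thesis by simp
  next
    case pos: False
    show ?thesis
    proof (cases "m = 0")
      case m: False
      have "real m * s \<le> 1 * s" using m False by (intro mult_right_mono_neg) auto
      then have "- 1 \<le> s" using pos by linarith
      then have "1 + real m * s \<le> (1 + s) ^ m" by (rule Bernoulli_inequality)
      then have "(1 + real m * s) * (1 - s) ^ m \<le> (1 + s) ^ m * (1 - s) ^ m"
        using s by (intro mult_right_mono) auto
      also have "\<dots> = (1 - s\<^sup>2) ^ m"
        by (simp add: power_mult_distrib[symmetric] power2_eq_square algebra_simps)
      also have "\<dots> \<le> 1"
      proof (rule power_le_one)
        have "s\<^sup>2 \<le> 1" using \<open>- 1 \<le> s\<close> s by (simp add: abs_square_le_1)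
        then show "0 \<le> 1 - s\<^sup>2" by simp
      qed simp
      finally show ?thesis .
    qed simp
  qed
  then show ?thesis using s False by (simp add: pos_le_divide_eq)
qed

lemma inverse_power_le_quadratic:
  "\<exists>C\<ge>0. \<forall>s::real. \<bar>s\<bar> \<le> 1/2 \<longrightarrow> 1 / (1 - s) ^ m \<le> 1 + real m * s + C * s\<^sup>2"
proof (induction m)
  case 0
  show ?case by (intro exI[of _ 0]) simp
next
  case (Suc m)
  then obtain C where C: "0 \<le> C" "\<And>s::real. \<bar>s\<bar> \<le> 1/2 \<Longrightarrow> 1 / (1 - s) ^ m \<le> 1 + real m * s + C * s\<^sup>2"
    by blast
  show ?case
  proof (intro exI[of _ "2 + 2 * real m + 3 * C"] conjI allI impI)
    fix s :: real assume s: "\<bar>s\<bar> \<le> 1/2"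
    have s1: "0 < 1 - s" using s by simp
    have "1 \<le> (1 + s + 2 * s\<^sup>2) * (1 - s)"
    proof -
      have "(1 + s + 2 * s\<^sup>2) * (1 - s) = 1 + s\<^sup>2 * (1 - 2 * s)"
        by (simp add: power2_eq_square algebra_simps)
      then show ?thesis using s by simp
    qed
    then have step: "1 / (1 - s) \<le> 1 + s + 2 * s\<^sup>2" using s1 by (simp add: pos_divide_le_eq)
    have "1 / (1 - s) ^ Suc m = (1 / (1 - s) ^ m) * (1 / (1 - s))" by simp
    also have "\<dots> \<le> (1 + real m * s + C * s\<^sup>2) * (1 + s + 2 * s\<^sup>2)"
    proof (intro mult_mono C step s)
      have "0 \<le> 1 / (1 - s) ^ m" using s1 by simp
      then show "0 \<le> 1 + real m * s + C * s\<^sup>2" using C(2)[OF s] by linarith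
    qed (use s1 in simp)
    also have "\<dots> = 1 + real (Suc m) * s + s\<^sup>2 * (2 + real m + 2 * real m * s + C * (1 + s + 2 * s\<^sup>2))"
      by (simp add: power2_eq_square algebra_simps)
    also have "\<dots> \<le> 1 + real (Suc m) * s + s\<^sup>2 * (2 + 2 * real m + 3 * C)"
    proof -
      have "s\<^sup>2 \<le> (1/2)\<^sup>2" using s by (intro abs_le_square_iff[THEN iffD1]) simp
      then have "1 + s + 2 * s\<^sup>2 \<le> 3" using s by (simp add: power2_eq_square)
      then have "C * (1 + s + 2 * s\<^sup>2) \<le> C * 3" using C by (intro mult_left_mono)
      moreover have "real m * (2 * s) \<le> real m * 1" using s by (intro mult_left_mono) auto
      ultimately have "2 + real m + 2 * real m * s + C * (1 + s + 2 * s\<^sup>2) \<le> 2 + 2 * real m + 3 * C"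
        by (simp add: mult_ac)
      then show ?thesis by (intro add_left_mono mult_left_mono) auto
    qed
    finally show "1 / (1 - s) ^ Suc m \<le> 1 + real (Suc m) * s + (2 + 2 * real m + 3 * C) * s\<^sup>2"
      by (simp add: mult.commute)
  qed (use C in simp)
qed

lemma linear_coefficient_zero:
  fixes A C \<delta> :: real
  assumes \<delta>: "0 < \<delta>" and C: "0 \<le> C" and nonneg: "\<And>\<epsilon>. \<bar>\<epsilon>\<bar> \<le> \<delta> \<Longrightarrow> 0 \<le> A * \<epsilon> + C * \<epsilon>\<^sup>2"
  shows "A = 0"
proof (rule ccontr)
  assume A: "A \<noteq> 0"
  define t where "t = min (\<delta> / \<bar>A\<bar>) (1 / (C + 1))"
  have t: "0 < t" "t * \<bar>A\<bar> \<le> \<delta>" "t \<le> 1 / (C + 1)"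
    using \<delta> C A by (auto simp: t_def pos_le_divide_eq[symmetric])
  have "\<bar>- A * t\<bar> \<le> \<delta>" using t by (simp add: abs_mult mult.commute)
  from nonneg[OF this] have "A\<^sup>2 * t \<le> A\<^sup>2 * t * (C * t)"
    by (simp add: power2_eq_square mult_ac)
  moreover have "0 < A\<^sup>2 * t" using A t by simp
  ultimately have "1 \<le> C * t" using mult_le_cancel_left_pos[of "A\<^sup>2 * t" 1 "C * t"] by simp
  also have "C * t \<le> C * (1 / (C + 1))" using C t by (intro mult_left_mono)
  also have "\<dots> < 1" using C by (simp add: field_simps)
  finally show False by simp
qed

text \<open>
  For small \<open>\<epsilon>\<close> the volume of the polar at \<open>\<epsilon> *\<^sub>R
  x\<close> is at most \<open>m + (n + 1) I \<epsilon> + C J \<epsilon>\<^sup>2\<close>, where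
  \<open>m\<close> is its value at \<open>\<epsilon> = 0\<close> and \<open>I\<close> the integral
  of \<open>x \<bullet> y\<close>. By minimality it is at least \<open>m\<close> for both signs of
  \<open>\<epsilon>\<close>, so \<open>I = 0\<close>.
\<close>
theorem santalo_point_imp_polar_centered:
  fixes K :: "'a::euclidean_space set"
  assumes K: "convex_body K" and p: "is_santalo_point K 0"
  shows "(LINT y:polar_at K 0|lborel. x \<bullet> y) = 0"
proof -
  let ?L = "polar_at K 0" and ?n = "DIM('a)"
  have z: "0 \<in> interior K" using p by (simp add: is_santalo_point_def)
  then have zK: "0 \<in> K" using interior_subset by blast
  have L: "convex_body ?L" by (rule convex_body_polar[OF K z])
  note int = convex_body_set_integrable[OF L]
  obtain e where e: "0 < e" "ball 0 e \<subseteq> interior K"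
    using z open_contains_ball[of "interior K"] by auto
  have "bounded ?L" using L by (auto simp: convex_body_def compact_imp_bounded)
  then obtain b where b: "0 < b" "\<And>y. y \<in> ?L \<Longrightarrow> norm y \<le> b" using bounded_pos by blast
  (* For these parameters the point stays in the interior of K and the functional is at most 1/2 on the polar. *)
  define \<delta> where "\<delta> = min (e / 2 / (norm x + 1)) (1 / (2 * b) / (norm x + 1))"
  have x1: "0 < norm x + 1" by (simp add: add_nonneg_pos)
  have \<delta>: "0 < \<delta>" using e b x1 by (simp add: \<delta>_def)
  obtain C where C: "0 \<le> C" "\<And>s::real. \<bar>s\<bar> \<le> 1/2 \<Longrightarrow> 1 / (1 - s) ^ Suc ?n \<le> 1 + real (Suc ?n) * s + C * s\<^sup>2"
    using inverse_power_le_quadratic[of "Suc ?n"] by blast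
  define I J where "I = (LINT y:?L|lborel. x \<bullet> y)" and "J = (LINT y:?L|lborel. (x \<bullet> y)\<^sup>2)"
  have "real (Suc ?n) * I = 0"
  proof (rule linear_coefficient_zero[OF \<delta>, where C = "C * J"])
    show "0 \<le> C * J" unfolding J_def set_lebesgue_integral_def
      by (intro mult_nonneg_nonneg C integral_nonneg_AE) (auto simp: indicator_def)
    fix \<epsilon> :: real assume \<epsilon>: "\<bar>\<epsilon>\<bar> \<le> \<delta>"
    have \<epsilon>x: "\<bar>\<epsilon>\<bar> * (norm x + 1) \<le> e / 2" "\<bar>\<epsilon>\<bar> * (norm x + 1) \<le> 1 / (2 * b)"
      using \<epsilon> unfolding \<delta>_def min.bounded_iff pos_le_divide_eq[OF x1] by auto
    have "\<bar>\<epsilon>\<bar> * norm x \<le> \<bar>\<epsilon>\<bar> * (norm x + 1)" by (intro mult_left_mono) auto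
    then have \<epsilon>n: "norm (\<epsilon> *\<^sub>R x) \<le> e / 2" "norm (\<epsilon> *\<^sub>R x) \<le> 1 / (2 * b)" using \<epsilon>x by auto
    then have xi: "\<epsilon> *\<^sub>R x \<in> interior K" using e by (intro subsetD[OF e(2)]) auto
    then have xK: "\<epsilon> *\<^sub>R x \<in> K" using interior_subset by blast
    have small: "\<bar>\<epsilon> * (x \<bullet> y)\<bar> \<le> 1/2" if "y \<in> ?L" for y
    proof -
      have "\<bar>(\<epsilon> *\<^sub>R x) \<bullet> y\<bar> \<le> norm (\<epsilon> *\<^sub>R x) * norm y" by (rule Cauchy_Schwarz_ineq2)
      also have "\<dots> \<le> 1 / (2 * b) * b" using \<epsilon>n b that by (intro mult_mono) auto
      finally show ?thesis using b by simp
    qed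
    have less1: "(\<epsilon> *\<^sub>R x) \<bullet> y < 1" if "y \<in> ?L" for y using small[OF that] by simp
    note pd = integrable_polar_density_less_1[OF L less1]
    have "volume_product K 0 \<le> volume_product K (\<epsilon> *\<^sub>R x)" using p xi by (simp add: is_santalo_point_def)
    then have "ennreal (measure lborel K) * emeasure lborel ?L \<le> ennreal (measure lborel K) * emeasure lborel (polar_at K (\<epsilon> *\<^sub>R x))"
      using K by (simp add: volume_product_def emeasure_convex_body[OF K, symmetric] convex_body_def borel_compact)
    then have le: "emeasure lborel ?L \<le> emeasure lborel (polar_at K (\<epsilon> *\<^sub>R x))"
      using measure_convex_body_pos[OF K] by (simp add: ennreal_mult_le_mult_iff)
    have "ennreal (measure lborel ?L) \<le> ennreal (\<integral>y. polar_density K (\<epsilon> *\<^sub>R x) y \<partial>lborel)"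
    proof -
      have "emeasure lborel (polar_at K (\<epsilon> *\<^sub>R x)) = ennreal (\<integral>y. polar_density K (\<epsilon> *\<^sub>R x) y \<partial>lborel)"
        by (rule emeasure_polar_eq_integral[OF xK zK pd(1)])
      then show ?thesis using le emeasure_convex_body[OF L] by simp
    qed
    moreover have "0 \<le> (\<integral>y. polar_density K (\<epsilon> *\<^sub>R x) y \<partial>lborel)"
      using polar_density_nonneg[OF xK] by (intro integral_nonneg_AE) auto
    ultimately have "measure lborel ?L \<le> (\<integral>y. polar_density K (\<epsilon> *\<^sub>R x) y \<partial>lborel)" by simp
    also have "\<dots> = (LINT y:?L|lborel. 1 / (1 - (\<epsilon> *\<^sub>R x) \<bullet> y) ^ Suc ?n)" by (rule pd(2))
    finally have "measure lborel ?L \<le> (LINT y:?L|lborel. 1 / (1 - (\<epsilon> *\<^sub>R x) \<bullet> y) ^ Suc ?n)" .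
    also have "(LINT y:?L|lborel. 1 / (1 - (\<epsilon> *\<^sub>R x) \<bullet> y) ^ Suc ?n) \<le> (LINT y:?L|lborel. (1 + real (Suc ?n) * \<epsilon> * (x \<bullet> y)) + C * \<epsilon>\<^sup>2 * (x \<bullet> y)\<^sup>2)"
    proof (rule set_integral_mono)
      show "set_integrable lborel ?L (\<lambda>y. 1 / (1 - (\<epsilon> *\<^sub>R x) \<bullet> y) ^ Suc ?n)"
        using pd(1) by (simp add: set_integrable_def polar_density_def[abs_def])
      show "set_integrable lborel ?L (\<lambda>y. (1 + real (Suc ?n) * \<epsilon> * (x \<bullet> y)) + C * \<epsilon>\<^sup>2 * (x \<bullet> y)\<^sup>2)"
        by (intro int continuous_intros)
      show "1 / (1 - (\<epsilon> *\<^sub>R x) \<bullet> y) ^ Suc ?n \<le> (1 + real (Suc ?n) * \<epsilon> * (x \<bullet> y)) + C * \<epsilon>\<^sup>2 * (x \<bullet> y)\<^sup>2"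
        if "y \<in> ?L" for y
        using C(2)[OF small[OF that]] by (simp add: power_mult_distrib mult_ac)
    qed
    also have "\<dots> = measure lborel ?L + real (Suc ?n) * \<epsilon> * I + C * \<epsilon>\<^sup>2 * J"
    proof -
      have "(LINT y:?L|lborel. (1 + real (Suc ?n) * \<epsilon> * (x \<bullet> y)) + C * \<epsilon>\<^sup>2 * (x \<bullet> y)\<^sup>2)
        = (LINT y:?L|lborel. 1 + real (Suc ?n) * \<epsilon> * (x \<bullet> y)) + (LINT y:?L|lborel. C * \<epsilon>\<^sup>2 * (x \<bullet> y)\<^sup>2)"
        by (intro set_integral_add int continuous_intros)
      also have "(LINT y:?L|lborel. 1 + real (Suc ?n) * \<epsilon> * (x \<bullet> y))
        = (LINT y:?L|lborel. 1) + (LINT y:?L|lborel. real (Suc ?n) * \<epsilon> * (x \<bullet> y))"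
        by (intro set_integral_add int continuous_intros)
      finally show ?thesis by (simp add: set_integral_const_body[OF L] I_def J_def del: of_nat_Suc)
    qed
    finally show "0 \<le> real (Suc ?n) * I * \<epsilon> + C * J * \<epsilon>\<^sup>2" by (simp add: mult_ac del: of_nat_Suc)
  qed
  then show ?thesis by (simp add: I_def del: of_nat_Suc)
qed

text \<open>
  Integrate \<open>inverse_power_ge\<close> over the polar body; the linear term vanishes because
  the body is centred.
\<close>
lemma polar_volume_ge:
  fixes K :: "'a::euclidean_space set"
  assumes L: "convex_body (polar_at K 0)" and xK: "x \<in> K" and zK: "0 \<in> K"
    and mean: "(LINT y:polar_at K 0|lborel. x \<bullet> y) = 0"
    and X: "emeasure lborel (polar_at K x) = ennreal X" "0 \<le> X"
  shows "measure lborel (polar_at K 0)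
      + real (Suc DIM('a)) * real (Suc (Suc DIM('a))) / 2 * (LINT y:polar_at K 0|lborel. (max 0 (x \<bullet> y))\<^sup>2) \<le> X"
proof -
  let ?L = "polar_at K 0" and ?n = "DIM('a)"
  note int = convex_body_set_integrable[OF L]
  have i: "integrable lborel (polar_density K x)"
    using X by (intro integrable_polar_density xK zK) simp
  have Xeq: "X = (\<integral>y. polar_density K x y \<partial>lborel)"
    using emeasure_polar_eq_integral[OF xK zK i] X
    by (subst (asm) X(1)) (auto simp: ennreal_inj integral_nonneg_AE polar_density_nonneg[OF xK])
  have "(LINT y:?L|lborel. (1 + real (Suc ?n) * (x \<bullet> y)) + real (Suc ?n) * real (Suc (Suc ?n)) / 2 * (max 0 (x \<bullet> y))\<^sup>2) \<le> X"
    unfolding Xeq set_lebesgue_integral_def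
  proof (rule integral_mono_AE)
    show "integrable lborel (\<lambda>y. indicator ?L y *\<^sub>R ((1 + real (Suc ?n) * (x \<bullet> y)) + real (Suc ?n) * real (Suc (Suc ?n)) / 2 * (max 0 (x \<bullet> y))\<^sup>2))"
      unfolding set_integrable_def[symmetric] by (intro int continuous_intros) auto
    show "AE y in lborel. indicator ?L y *\<^sub>R ((1 + real (Suc ?n) * (x \<bullet> y)) + real (Suc ?n) * real (Suc (Suc ?n)) / 2 * (max 0 (x \<bullet> y))\<^sup>2) \<le> polar_density K x y"
      using AE_inner_neq[of x 1, simplified]
    proof eventually_elim
      case (elim y)
      show ?case
      proof (cases "y \<in> ?L")
        case True
        then have "x \<bullet> y < 1" using polar_inner_le_1[OF xK True] elim by simp
        from inverse_power_ge[OF this, of "Suc ?n"] show ?thesis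
          using True by (simp add: polar_density_def del: of_nat_Suc power_Suc)
      qed (simp add: polar_density_def)
    qed
  qed (rule i)
  also have "(LINT y:?L|lborel. (1 + real (Suc ?n) * (x \<bullet> y)) + real (Suc ?n) * real (Suc (Suc ?n)) / 2 * (max 0 (x \<bullet> y))\<^sup>2)
      = (LINT y:?L|lborel. 1 + real (Suc ?n) * (x \<bullet> y)) + (LINT y:?L|lborel. real (Suc ?n) * real (Suc (Suc ?n)) / 2 * (max 0 (x \<bullet> y))\<^sup>2)"
    by (intro set_integral_add int continuous_intros) auto
  also have "(LINT y:?L|lborel. 1 + real (Suc ?n) * (x \<bullet> y)) = (LINT y:?L|lborel. 1) + (LINT y:?L|lborel. real (Suc ?n) * (x \<bullet> y))"
    by (intro set_integral_add int continuous_intros)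
  finally show ?thesis using mean by (simp add: set_integral_const_body[OF L] del: of_nat_Suc)
qed

text \<open>
  The bound \<open>q\<close> is one for the square of the apex height of the comparison cone. As
  \<open>q < 1\<close>, the functional stays below 1 on the polar body, so \<open>x \<in> K\<close>
  by the bipolar theorem, and the integral formula applies.
\<close>
lemma polar_volume_le:
  fixes K :: "'a::euclidean_space set"
  assumes K: "convex_body K" and zK: "0 \<in> K" and polar: "convex_body (polar_at K 0)"
    and x: "x \<noteq> 0" and mean: "(LINT y:polar_at K 0|lborel. x \<bullet> y) = 0"
    and q: "real DIM('a) * (real DIM('a) + 2) * ((LINT y:polar_at K 0|lborel. (x \<bullet> y)\<^sup>2) / measure lborel (polar_at K 0)) \<le> q" "q < 1"
  shows "x \<in> K" and "\<exists>X\<ge>0. emeasure lborel (polar_at K x) = ennreal X \<and> X \<le> measure lborel (polar_at K 0) / (1 - q)"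
proof -
  let ?L = "polar_at K 0"
  define Z where "Z = real DIM('a) * (real DIM('a) + 2) * ((LINT y:?L|lborel. (x \<bullet> y)\<^sup>2) / measure lborel ?L)"
  define r where "r = sqrt Z"
  interpret centered_body ?L x r unfolding r_def Z_def by (rule centered_bodyI[OF polar x mean])
  have "0 < Z" using r by (simp add: r_def)
  then have "r\<^sup>2 = Z" by (simp add: r_def)
  moreover have "Z \<le> q" unfolding Z_def by (rule q(1))
  ultimately have r2: "r\<^sup>2 \<le> q" by simp
  then have "r\<^sup>2 < 1" using q(2) by simp
  then have r1: "r < 1" by (simp add: abs_square_less_1)
  have less1: "x \<bullet> y < 1" if "y \<in> ?L" for y using functional_le[OF that] r1 by simp
  show xK: "x \<in> K"
    by (rule polar_at_bipolar) (use K zK less1 in \<open>auto simp: convex_body_def compact_imp_closed less_imp_le\<close>)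
  note pd = integrable_polar_density_less_1[OF polar less1]
  have "(LINT y:?L|lborel. 1 / (1 - x \<bullet> y) ^ Suc DIM('a)) \<le> measure lborel ?L / (1 - r\<^sup>2)"
    by (rule integral_inverse_power_le[OF r1])
  also have "\<dots> \<le> measure lborel ?L / (1 - q)"
    using r2 q(2) by (intro divide_left_mono) auto
  finally have "(\<integral>y. polar_density K x y \<partial>lborel) \<le> measure lborel ?L / (1 - q)"
    by (simp only: pd(2))
  moreover have "0 \<le> (\<integral>y. polar_density K x y \<partial>lborel)"
    using polar_density_nonneg[OF xK] by (intro integral_nonneg_AE) auto
  ultimately show "\<exists>X\<ge>0. emeasure lborel (polar_at K x) = ennreal X \<and> X \<le> measure lborel ?L / (1 - q)"
    using emeasure_polar_eq_integral[OF xK zK pd(1)] by blast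
qed

section \<open>Santalo regions and the Binet ellipsoid\<close>

lemma normalized_product0_eq:
  fixes K :: "'a::euclidean_space set"
  assumes K: "convex_body K"
  shows "normalized_product0 K = measure lborel K * measure lborel (polar_at K 0) / (measure lborel (cball (0::'a) 1))\<^sup>2"
  using K unfolding normalized_product0_def
  by (simp add: convex_body_def borel_compact)

lemma unit_ball_measure_pos: "0 < measure lborel (cball (0::'a::euclidean_space) 1)"
  by (rule measure_convex_body_pos) (simp add: convex_body_def)

text \<open>
  The defining inequality compares extended reals; it forces the polar volume to be finite, after
  which it is an inequality between real numbers.
\<close>
lemma santalo_region_iff:
  fixes K :: "'a::euclidean_space set"
  assumes K: "convex_body K" and L: "convex_body (polar_at K 0)"
  shows "x \<in> santalo_region K t \<longleftrightarrow> x \<in> K \<and> (\<exists>X\<ge>0. emeasure lborel (polar_at K x) = ennreal X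
      \<and> normalized_product0 K * (X / measure lborel (polar_at K 0)) \<le> t)"
proof -
  define v k l where "v = measure lborel (cball (0::'a) 1)" and "k = measure lborel K"
    and "l = measure lborel (polar_at K 0)"
  have pos: "0 < v" "0 < k" "0 < l" unfolding v_def k_def l_def using unit_ball_measure_pos measure_convex_body_pos K L by auto
  have v: "emeasure lebesgue (cball (0::'a) 1) = ennreal v"
    using emeasure_convex_body[of "cball (0::'a) 1"] by (simp add: convex_body_def v_def)
  have k: "emeasure lebesgue K = ennreal k"
    using emeasure_convex_body[OF K] K by (simp add: convex_body_def borel_compact k_def)
  have vp: "volume_product K x = ennreal k * emeasure lborel (polar_at K x)"
    unfolding volume_product_def k by simp
  show ?thesis
  proof (cases "emeasure lborel (polar_at K x)")
    case (real X)
    have "volume_product K x / (emeasure lebesgue (cball (0::'a) 1))\<^sup>2 = ennreal (k * X / v\<^sup>2)"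
    proof -
      have "ennreal k * ennreal X / ennreal (v\<^sup>2) = ennreal (k * X / v\<^sup>2)"
        using pos real by (subst ennreal_mult[symmetric]) (auto intro!: divide_ennreal)
      then show ?thesis unfolding vp v real(2) using pos by (simp add: ennreal_power)
    qed
    moreover have "normalized_product0 K * (X / l) = k * X / v\<^sup>2"
      using pos unfolding normalized_product0_eq[OF K] v_def[symmetric] k_def[symmetric] l_def[symmetric] by simp
    ultimately show ?thesis
      using real pos by (auto simp: santalo_region_def enn2ereal_ennreal l_def[symmetric])
  next
    case top
    have "volume_product K x = top" unfolding vp top using pos by (simp add: ennreal_mult_top)
    then have "volume_product K x / (emeasure lebesgue (cball (0::'a) 1))\<^sup>2 = top"
      unfolding v using pos by (simp add: ennreal_power ennreal_top_divide)
    then show ?thesis using top by (simp add: santalo_region_def)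
  qed
qed

lemma binet_norm_eq:
  fixes L :: "'a::euclidean_space set"
  assumes "convex_body L"
  shows "binet_norm L u = sqrt ((LINT y:L|lborel. (u \<bullet> y)\<^sup>2) / measure lborel L)"
proof -
  have [measurable]: "L \<in> sets borel" using assms by (simp add: convex_body_def borel_compact)
  have "(LINT x:L|lebesgue. (x \<bullet> u)\<^sup>2) = (LINT y:L|lborel. (u \<bullet> y)\<^sup>2)"
    unfolding set_lebesgue_integral_def by (subst integral_completion) (auto simp: inner_commute)
  then show ?thesis by (simp add: binet_norm_def)
qed

lemma binet_norm_scaleR: "binet_norm L (c *\<^sub>R u) = \<bar>c\<bar> * binet_norm L u"
proof -
  have "(LINT x:L|lebesgue. (x \<bullet> (c *\<^sub>R u))\<^sup>2) = c\<^sup>2 * (LINT x:L|lebesgue. (x \<bullet> u)\<^sup>2)"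
    by (simp add: power_mult_distrib)
  then show ?thesis unfolding binet_norm_def
    by (simp add: real_sqrt_mult[symmetric] real_sqrt_abs[symmetric] mult.left_commute del: real_sqrt_abs)
qed

lemma binet_norm_nonneg: "convex_body L \<Longrightarrow> 0 \<le> binet_norm L u"
  by (auto simp: binet_norm_eq set_lebesgue_integral_def indicator_def intro!: divide_nonneg_nonneg integral_nonneg_AE)

theorem theorem7:
  fixes K :: "(real ^ 'n) set" and t :: real
  assumes "convex_body K"
    and "is_santalo_point K 0"
  shows "(santalo_region K t \<noteq> {} \<longleftrightarrow> t \<ge> normalized_product0 K) \<and>
    (santalo_region K t \<noteq> {} \<longrightarrow>
      (*\<^sub>R) (inner_factor K t) ` binet_ellipsoid (polar_at K 0) \<subseteq> santalo_region K t \<and>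
      santalo_region K t \<subseteq> (*\<^sub>R) (outer_factor K t) ` binet_ellipsoid (polar_at K 0))"
proof -
  note K = assms(1)
  let ?L = "polar_at K 0" and ?N = "normalized_product0 K" and ?n = "real CARD('n)"
  let ?m = "measure lborel (polar_at K 0)"
  have z: "0 \<in> interior K" using assms(2) by (simp add: is_santalo_point_def)
  then have zK: "0 \<in> K" using interior_subset by blast
  have L: "convex_body ?L" by (rule convex_body_polar[OF K z])
  have mean: "(LINT y:?L|lborel. x \<bullet> y) = 0" for x
    by (rule santalo_point_imp_polar_centered[OF assms])
  have m: "0 < ?m" by (rule measure_convex_body_pos[OF L])
  have N: "0 < ?N"
    using measure_convex_body_pos[OF K] m unit_ball_measure_pos[where 'a = "real ^ 'n"]
    by (simp add: normalized_product0_eq[OF K])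
  have n: "1 \<le> ?n" by (simp add: Suc_le_eq)
  have region0: "0 \<in> santalo_region K t \<longleftrightarrow> ?N \<le> t"
    using m zK by (auto simp: santalo_region_iff[OF K L] emeasure_convex_body[OF L] intro!: exI[of _ ?m])
  have upper: "(?n + 1) * (?n + 2) / 2 * (LINT y:?L|lborel. (max 0 (x \<bullet> y))\<^sup>2) \<le> ?m * (t / ?N - 1)"
    if x: "x \<in> santalo_region K t" for x
  proof -
    obtain X where X: "x \<in> K" "emeasure lborel (polar_at K x) = ennreal X" "0 \<le> X" "?N * (X / ?m) \<le> t"
      using x by (auto simp: santalo_region_iff[OF K L])
    have "X \<le> ?m * (t / ?N)" using X(4) N m by (simp add: field_simps)
    then show ?thesis
      using polar_volume_ge[OF L X(1) zK mean X(2,3)] by (simp add: algebra_simps)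
  qed
  have upper0: "0 \<le> (LINT y:?L|lborel. (max 0 (x \<bullet> y))\<^sup>2)" for x
    unfolding set_lebesgue_integral_def by (intro integral_nonneg_AE) (auto simp: indicator_def)
  have nonempty: "santalo_region K t \<noteq> {} \<longleftrightarrow> ?N \<le> t"
  proof
    assume "santalo_region K t \<noteq> {}"
    then obtain x where x: "x \<in> santalo_region K t" by auto
    have "0 \<le> (?n + 1) * (?n + 2) / 2 * (LINT y:?L|lborel. (max 0 (x \<bullet> y))\<^sup>2)"
      using upper0 n by (intro mult_nonneg_nonneg) auto
    then have "0 \<le> ?m * (t / ?N - 1)" using upper[OF x] by linarith
    then show "?N \<le> t" using m N by (simp add: zero_le_mult_iff)
  qed (use region0 in auto)
  have inner: "(*\<^sub>R) (inner_factor K t) ` binet_ellipsoid ?L \<subseteq> santalo_region K t" if t: "?N \<le> t"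
  proof
    fix x assume "x \<in> (*\<^sub>R) (inner_factor K t) ` binet_ellipsoid ?L"
    then obtain u where u: "binet_norm ?L u \<le> 1" "x = inner_factor K t *\<^sub>R u"
      by (auto simp: binet_ellipsoid_def)
    show "x \<in> santalo_region K t"
    proof (cases "x = 0")
      case False
      define q where "q = 1 - ?N / t"
      have tpos: "0 < t" using t N by simp
      have q: "0 \<le> q" "q < 1" "1 - q = ?N / t" using t N tpos by (auto simp: q_def)
      have if0: "0 \<le> inner_factor K t" using q n by (simp add: inner_factor_def q_def)
      have V: "(LINT y:?L|lborel. (x \<bullet> y)\<^sup>2) / ?m = (binet_norm ?L x)\<^sup>2"
        using binet_norm_nonneg[OF L, of x] unfolding binet_norm_eq[OF L]
        by (simp add: real_sqrt_ge_0_iff)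
      have "binet_norm ?L x \<le> inner_factor K t * 1"
        unfolding u(2) binet_norm_scaleR using if0 u(1) by (simp add: mult_left_le)
      then have "(binet_norm ?L x)\<^sup>2 \<le> (inner_factor K t)\<^sup>2"
        using binet_norm_nonneg[OF L, of x] by (intro power_mono) auto
      also have "(inner_factor K t)\<^sup>2 = q / (3 * ?n\<^sup>2)"
        using q by (simp add: inner_factor_def q_def[symmetric] power_mult_distrib power_divide)
      finally have "?n * (?n + 2) * ((LINT y:?L|lborel. (x \<bullet> y)\<^sup>2) / ?m) \<le> ?n * (?n + 2) * (q / (3 * ?n\<^sup>2))"
        unfolding V using n by (intro mult_left_mono) auto
      also have "\<dots> = q * ((?n + 2) / (3 * ?n))" using n by (simp add: power2_eq_square)
      (* This is n (n + 2) <= 3 n^2, the reason for the factor 3 in the inner constant. *)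
      also have "\<dots> \<le> q * 1" using q n by (intro mult_left_mono) (auto simp: pos_divide_le_eq)
      finally have le: "real DIM(real ^ 'n) * (real DIM(real ^ 'n) + 2) * ((LINT y:?L|lborel. (x \<bullet> y)\<^sup>2) / ?m) \<le> q"
        by simp
      obtain X where X: "0 \<le> X" "emeasure lborel (polar_at K x) = ennreal X" "X \<le> ?m / (1 - q)"
        using polar_volume_le(2)[OF K zK L False mean le q(2)] by blast
      have "?N * (X / ?m) \<le> t"
      proof -
        have "X \<le> ?m * t / ?N" using X(3) N tpos unfolding q(3) by simp
        then show ?thesis using N m by (simp add: field_simps)
      qed
      then show ?thesis
        using polar_volume_le(1)[OF K zK L False mean le q(2)] X by (auto simp: santalo_region_iff[OF K L])
    qed (use region0 t in simp)
  qed
  have outer: "santalo_region K t \<subseteq> (*\<^sub>R) (outer_factor K t) ` binet_ellipsoid ?L" if t: "?N \<le> t"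
  proof
    fix x assume x: "x \<in> santalo_region K t"
    have tpos: "0 < t" using t N by simp
    define \<tau> where "\<tau> = t / ?N"
    have \<tau>: "1 \<le> \<tau>" "?N / t = 1 / \<tau>" using t N tpos by (auto simp: \<tau>_def)
    have e: "2 < exp (1::real)" "exp (1::real) \<le> 3"
      using exp_lower_Taylor_quadratic[of 1] exp_le by auto
    define P where "P = (exp 1 - 2) * (?n + 1) * (?n + 2)"
    have P: "0 < P" unfolding P_def using e n by (intro mult_pos_pos) auto
    define c where "c = outer_factor K t"
    have c0: "0 \<le> c" unfolding c_def outer_factor_def \<tau>(2) \<tau>_def[symmetric] P_def[symmetric]
      using P \<tau> by (intro mult_nonneg_nonneg divide_nonneg_nonneg) auto
    have c2: "c\<^sup>2 = 8 / P * (\<tau> - 1)"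
    proof -
      have "c\<^sup>2 = (2 * sqrt 2 / sqrt P)\<^sup>2 * (sqrt \<tau>)\<^sup>2 * (sqrt (1 - 1 / \<tau>))\<^sup>2"
        unfolding c_def outer_factor_def \<tau>(2) \<tau>_def[symmetric] P_def[symmetric] by (simp add: power_mult_distrib power_divide)
      also have "\<dots> = 8 / P * (\<tau> * (1 - 1 / \<tau>))" using P \<tau>(1) by (simp add: power_mult_distrib power_divide)
      also have "\<tau> * (1 - 1 / \<tau>) = \<tau> - 1" using \<tau>(1) by (simp add: right_diff_distrib)
      finally show ?thesis .
    qed
    have bound: "binet_norm ?L x \<le> c"
    proof (cases "x = 0")
      case True
      then show ?thesis using c0 binet_norm_scaleR[of ?L 0 0] by simp
    next
      case False
      define V where "V = (LINT y:?L|lborel. (x \<bullet> y)\<^sup>2)"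
      have V: "0 < V" unfolding V_def by (rule second_moment_pos[OF L False])
      have "(1 - 2 / exp 1) * V \<le> (LINT y:?L|lborel. (max 0 (x \<bullet> y))\<^sup>2)"
        unfolding V_def by (rule centered_body.second_moment_le_upper[OF centered_bodyI[OF L False mean]])
      then have "(?n + 1) * (?n + 2) / 2 * ((1 - 2 / exp 1) * V) \<le> ?m * (\<tau> - 1)"
        using upper[OF x] n unfolding \<tau>_def[symmetric]
        by (elim order_trans[OF mult_left_mono]) auto
      moreover have "(?n + 1) * (?n + 2) / 2 * ((1 - 2 / exp 1) * V) = P / (2 * exp 1) * V"
        by (simp add: P_def field_simps)
      ultimately have "P / (2 * exp 1) * V \<le> ?m * (\<tau> - 1)" by simp
      then have "V / ?m \<le> 2 * exp 1 / P * (\<tau> - 1)" using P m by (simp add: field_simps)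
      (* The argument yields 2 e instead of 8; e <= 3 suffices here. *)
      also have "\<dots> \<le> 8 / P * (\<tau> - 1)"
        using e \<tau> P by (intro mult_right_mono divide_right_mono) auto
      finally have "V / ?m \<le> c\<^sup>2" unfolding c2 .
      then have "sqrt (V / ?m) \<le> c" using c0 by (rule real_le_lsqrt[rotated])
      then show ?thesis by (simp add: binet_norm_eq[OF L] V_def)
    qed
    show "x \<in> (*\<^sub>R) (outer_factor K t) ` binet_ellipsoid ?L"
    proof (cases "c = 0")
      case True
      have "x = 0"
      proof (rule ccontr)
        assume "x \<noteq> 0"
        from second_moment_pos[OF L this] have "0 < binet_norm ?L x" using m by (simp add: binet_norm_eq[OF L])
        then show False using bound True by simp
      qed
      moreover have "0 \<in> binet_ellipsoid ?L"
        using binet_norm_scaleR[of ?L 0 0] by (simp add: binet_ellipsoid_def)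
      ultimately show ?thesis by force
    next
      case False
      then have c: "0 < c" using c0 by simp
      have "(1 / c) *\<^sub>R x \<in> binet_ellipsoid ?L"
        using bound c unfolding binet_ellipsoid_def by (simp add: binet_norm_scaleR)
      moreover have "x = c *\<^sub>R ((1 / c) *\<^sub>R x)" using c by simp
      ultimately show ?thesis unfolding c_def[symmetric] by (rule image_eqI[rotated])
    qed
  qed
  show ?thesis using nonempty inner outer by auto
qed

end
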